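(* Let $A_1,\ldots,A_6\in\mathbb{P}^2$ be the vertices of a hexagon $\mathcal{H}$ in the complex projective plane, and let $\mathcal{A}=\mathcal{A}(A_1,\ldots,A_6): f=0$ be the associated hexagonal arrangement with lines $L_1,\ldots,L_6$ (sides) and $L_1',L_2',L_3'$ (diagonals, $L_k':\ell_k'=0$). Assume that $A_1,\ldots,A_6$ are situated on a conic which is either smooth or a union of two distinct lines, and that $\mathcal{A}$ consists of 9 distinct lines and has only double points except for 6 triple points, situated at $A_1,\ldots,A_6$. Let $L:\ell=0$ be the line containing the three points $B_k=L_k\cap L_{k+3}$, $k=1,2,3$ (which are collinear by Pascal's Theorem). Then there is a nonzero quartic form $q_{\mathcal{A}}\in S_4$ such that $q_{\mathcal{A}}$ vanishes on the set of 12 points $$\{A_1,A_2,A_3,A_4,A_5,A_6,A_1',A_2',A_3',A_4',A_5',A_6'\},$$ where $A_j'=L_j\cap L_{j+2}$, and the corresponding octic form $$h_{\mathcal{A}}=\ell\cdot\ell_1'\cdot\ell_2'\cdot\ell_3'\cdot q_{\mathcal{A}}$$ belongs to $I_8$ but not to $J_8$.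
   Context: $S=\mathbb{C}[x,y,z]$ with its standard grading; $S_k$ is the space of homogeneous polynomials of degree $k$, and for a homogeneous ideal $K\subset S$, $K_k=K\cap S_k$. Hexagonal arrangement: given points $A_1,\ldots,A_6\in\mathbb{P}^2=\mathbb{P}^2(\mathbb{C})$, with $A_7=A_1$, the sides of the hexagon $\mathcal{H}$ are the lines $L_j:\ell_j=0$ determined by $A_j$ and $A_{j+1}$, $j=1,\ldots,6$, and the diagonals are the lines $L_k':\ell_k'=0$ determined by $A_k$ and $A_{k+3}$, $k=1,2,3$; here $\ell_j,\ell_k'\in S_1$ are linear forms. Set $\mathcal{A}(A_1,\ldots,A_6)=L_1\cup\cdots\cup L_6\cup L_1'\cup L_2'\cup L_3'$, with defining equation $f=\ell_1\cdots\ell_6\,\ell_1'\ell_2'\ell_3'=0$ of degree 9. Indices of sides are taken cyclically: $L_7=L_1$, $L_8=L_2$. A double (resp. triple) point of the arrangement is a point lying on exactly two (resp. three) of its lines. $J=J_f=(f_x,f_y,f_z)\subset S$ is the Jacobian ideal of $f$, generated by the partial derivatives of $f$, and $I=I_f$ is the saturation of $J$ with respect to the maximal ideal $(x,y,z)$. *)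

theory Defs
  imports "HOL-Analysis.Analysis" "HOL-Library.Poly_Mapping"
begin

text \<open>The variables of \<open>S = \<complex>[x,y,z]\<close> are indexed by the type \<open>3\<close>, as are the coordinates of \<open>\<complex>\<^sup>3\<close>. A polynomial
  maps exponent vectors to coefficients with finite support; \<open>HOL-Library.Poly_Mapping\<close> provides
  the (convolution) ring structure.\<close>

type_synonym monom3 = "3 \<Rightarrow>\<^sub>0 nat"
type_synonym poly3 = "monom3 \<Rightarrow>\<^sub>0 complex"

definition Var :: "3 \<Rightarrow> poly3" where
  "Var i = Poly_Mapping.single (Poly_Mapping.single i 1) 1"

definition eval :: "poly3 \<Rightarrow> complex ^ 3 \<Rightarrow> complex" where
  "eval p v = (\<Sum>m\<in>Poly_Mapping.keys p.
     Poly_Mapping.lookup p m * (\<Prod>i\<in>UNIV. (v $ i) ^ Poly_Mapping.lookup m i))"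

definition monom_degree :: "monom3 \<Rightarrow> nat" where
  "monom_degree m = (\<Sum>i\<in>UNIV. Poly_Mapping.lookup m i)"

text \<open>\<open>forms k\<close> is the vector space \<open>S\<^sub>k\<close>; it contains \<open>0\<close>.\<close>

definition forms :: "nat \<Rightarrow> poly3 set" where
  "forms k = {p. \<forall>m\<in>Poly_Mapping.keys p. monom_degree m = k}"

text \<open>In the terms with exponent \<open>0\<close> of the \<open>i\<close>-th variable the exponent subtraction is truncated,
  but there the coefficient is \<open>0\<close>.\<close>

definition partial_deriv :: "3 \<Rightarrow> poly3 \<Rightarrow> poly3" where
  "partial_deriv i p = (\<Sum>m\<in>Poly_Mapping.keys p.
     Poly_Mapping.single (m - Poly_Mapping.single i 1)
       (of_nat (Poly_Mapping.lookup m i) * Poly_Mapping.lookup p m))"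

definition ideal_gen :: "'a::comm_ring_1 set \<Rightarrow> 'a set" where
  "ideal_gen = module.span (*)"

definition ideal_power :: "'a::comm_ring_1 set \<Rightarrow> nat \<Rightarrow> 'a set" where
  "ideal_power I n = ideal_gen {\<Prod>i<n. a i | a. \<forall>i<n. a i \<in> I}"

definition ideal_quotient :: "'a::comm_ring_1 set \<Rightarrow> 'a set \<Rightarrow> 'a set" where
  "ideal_quotient I K = {g. \<forall>a\<in>K. a * g \<in> I}"

definition saturation :: "'a::comm_ring_1 set \<Rightarrow> 'a set \<Rightarrow> 'a set" where
  "saturation I K = (\<Union>n. ideal_quotient I (ideal_power K n))"

definition max_ideal :: "poly3 set" where
  "max_ideal = ideal_gen {Var 1, Var 2, Var 3}"

definition jacobian_ideal :: "poly3 \<Rightarrow> poly3 set" where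
  "jacobian_ideal f = ideal_gen {partial_deriv 1 f, partial_deriv 2 f, partial_deriv 3 f}"

definition sat_jacobian_ideal :: "poly3 \<Rightarrow> poly3 set" where
  "sat_jacobian_ideal f = saturation (jacobian_ideal f) max_ideal"

definition graded_part :: "poly3 set \<Rightarrow> nat \<Rightarrow> poly3 set" where
  "graded_part K k = K \<inter> forms k"

text \<open>A point of \<open>\<P>\<^sup>2(\<complex>)\<close> is given by a nonzero vector of homogeneous coordinates, and two such
  vectors give the same point iff they are proportional. A curve with a given equation is the
  set of all nonzero representatives of its points.\<close>

definition same_point :: "complex ^ 3 \<Rightarrow> complex ^ 3 \<Rightarrow> bool" where
  "same_point u v \<longleftrightarrow> (\<exists>c. c \<noteq> 0 \<and> u = c *s v)"

definition zero_locus :: "poly3 \<Rightarrow> (complex ^ 3) set" where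
  "zero_locus p = {v. v \<noteq> 0 \<and> eval p v = 0}"

definition linear_form :: "poly3 \<Rightarrow> bool" where
  "linear_form p \<longleftrightarrow> p \<in> forms 1 \<and> p \<noteq> 0"

definition line_through :: "poly3 \<Rightarrow> complex ^ 3 \<Rightarrow> complex ^ 3 \<Rightarrow> bool" where
  "line_through p u v \<longleftrightarrow> linear_form p \<and> u \<in> zero_locus p \<and> v \<in> zero_locus p"

definition smooth_conic :: "poly3 \<Rightarrow> bool" where
  "smooth_conic Q \<longleftrightarrow> Q \<in> forms 2 \<and> Q \<noteq> 0 \<and>
     (\<forall>v\<in>zero_locus Q. \<exists>i. eval (partial_deriv i Q) v \<noteq> 0)"

definition two_lines_conic :: "poly3 \<Rightarrow> bool" where
  "two_lines_conic Q \<longleftrightarrow> (\<exists>m1 m2. linear_form m1 \<and> linear_form m2 \<and>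
     zero_locus m1 \<noteq> zero_locus m2 \<and> Q = m1 * m2)"

text \<open>Vertices \<open>A\<close> and side equations \<open>l\<close> are indexed by the type \<open>6\<close>, whose arithmetic is modulo 6
  (so \<open>6 = 0\<close> and \<open>7 = 1\<close>). The diagonal equations \<open>d\<close> are relevant only for the
  indices 1, 2, 3.\<close>

definition hexagon :: "(6 \<Rightarrow> complex ^ 3) \<Rightarrow> (6 \<Rightarrow> poly3) \<Rightarrow> (6 \<Rightarrow> poly3) \<Rightarrow> bool" where
  "hexagon A l d \<longleftrightarrow>
     (\<forall>j. A j \<noteq> 0) \<and> (\<forall>i j. i \<noteq> j \<longrightarrow> \<not> same_point (A i) (A j)) \<and>
     (\<forall>j. line_through (l j) (A j) (A (j + 1))) \<and>
     (\<forall>k\<in>{1, 2, 3}. line_through (d k) (A k) (A (k + 3)))"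

definition hex_lines :: "(6 \<Rightarrow> poly3) \<Rightarrow> (6 \<Rightarrow> poly3) \<Rightarrow> (complex ^ 3) set set" where
  "hex_lines l d = (\<lambda>j. zero_locus (l j)) ` UNIV \<union> (\<lambda>k. zero_locus (d k)) ` {1, 2, 3}"

definition hex_poly :: "(6 \<Rightarrow> poly3) \<Rightarrow> (6 \<Rightarrow> poly3) \<Rightarrow> poly3" where
  "hex_poly l d = (\<Prod>j\<in>UNIV. l j) * (d 1 * d 2 * d 3)"

definition multiplicity_at :: "(complex ^ 3) set set \<Rightarrow> complex ^ 3 \<Rightarrow> nat" where
  "multiplicity_at \<L> v = card {M\<in>\<L>. v \<in> M}"

definition double_point :: "(complex ^ 3) set set \<Rightarrow> complex ^ 3 \<Rightarrow> bool" where
  "double_point \<L> v \<longleftrightarrow> v \<noteq> 0 \<and> multiplicity_at \<L> v = 2"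

definition triple_point :: "(complex ^ 3) set set \<Rightarrow> complex ^ 3 \<Rightarrow> bool" where
  "triple_point \<L> v \<longleftrightarrow> v \<noteq> 0 \<and> multiplicity_at \<L> v = 3"

text \<open>The points \<open>B\<^sub>k\<close> are the intersections of opposite sides.\<close>

definition pascal_line :: "(6 \<Rightarrow> poly3) \<Rightarrow> poly3 \<Rightarrow> bool" where
  "pascal_line l p \<longleftrightarrow> linear_form p \<and>
     (\<forall>k\<in>{1, 2, 3}. zero_locus (l k) \<inter> zero_locus (l (k + 3)) \<subseteq> zero_locus p)"

end

theory Submission
  imports Defs
begin

text \<open>
  The proof rests on a normal form of the arrangement. By Pascal's theorem (\<open>pascal\<close>) the
  equations of the six sides can be scaled to \<open>n j\<close> in such a way that \<open>n j + n (j + 3) = E\<close> for all six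
  indices, with \<open>E\<close> the Pascal line. Then the diagonal through the vertex \<open>A j\<close> is \<open>n j - n (j - 1)\<close>
  (\<open>diagonal_eq\<close>), and the whole arrangement has become invariant under rotation of the hexagon. The quartic
  form is \<open>P\<^sub>1 P\<^sub>2 + P\<^sub>2 P\<^sub>3 + P\<^sub>3 P\<^sub>1\<close> with \<open>P\<^sub>j = n j * n (j + 3)\<close>. It vanishes where adjacent or
  alternate sides meet, since every summand contains one of two such sides.

  Membership of the octic form in the saturation \<open>I\<close> is a local condition at the multiple points. At the 18
  double points the local ideal is the maximal one, and one factor of the octic form vanishes: a diagonal,
  the quartic form, or the Pascal line. At a vertex, with sides \<open>x = n j\<close> and \<open>y = n (j - 1)\<close>, the local
  ideal is generated by the partial derivatives of \<open>x y (x - y)\<close>. It contains all cubics and the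
  quadric \<open>(x - y) (x + y)\<close>, which up to a factor and up to cubics and multiples of \<open>x y (x - y)\<close> is the
  octic form: the diagonal contributes \<open>x - y\<close>, and the quartic form has the tangent \<open>x + y\<close> because of
  \<open>n j * n (j + 3) = x (E - x)\<close> (\<open>quartic_at_vertex\<close>, \<open>jacobian_at_triple_point\<close>). That these local
  statements imply membership in the saturation is shown without the Nullstellensatz, by an induction over
  sets of lines (\<open>saturation_if_local\<close>).

  The elements of degree 8 of the Jacobian ideal are the directional derivatives of \<open>f\<close>
  (\<open>jacobian_lowest_degree\<close>). If such a derivative vanishes on the three diagonals, then its direction is a
  common point of them; as they are not concurrent, the derivative is zero, unlike the octic form
  (\<open>octic_not_in_jacobian\<close>).
\<close>

section \<open>Evaluation of polynomials\<close>

lemma poly3_induct [case_names zero monomial add]: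
  fixes p :: poly3
  assumes "P 0" "\<And>m c. P (Poly_Mapping.single m c)" "\<And>p r. P p \<Longrightarrow> P r \<Longrightarrow> P (p + r)"
  shows "P p"
proof (induction p rule: update_induct)
  case const
  show ?case by (rule assms(1))
next
  case (update p m c)
  have "Poly_Mapping.update m c p = p + Poly_Mapping.single m c"
    using update(1) by (intro poly_mapping_eqI)
      (auto simp: lookup_update lookup_add lookup_single in_keys_iff when_def)
  then show ?case using assms(2,3) update(3) by simp
qed

abbreviation const_poly :: "complex \<Rightarrow> poly3" where
  "const_poly c \<equiv> Poly_Mapping.single 0 c"

lemma eval_superset:
  assumes "finite S" "Poly_Mapping.keys p \<subseteq> S"
  shows "eval p v = (\<Sum>m\<in>S. Poly_Mapping.lookup p m * (\<Prod>i\<in>UNIV. (v $ i) ^ Poly_Mapping.lookup m i))"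
  unfolding eval_def using assms
  by (intro sum.mono_neutral_left) (auto simp: in_keys_iff)

lemma eval_0 [simp]: "eval 0 v = 0"
  by (simp add: eval_def)

lemma eval_single: "eval (Poly_Mapping.single m c) v = c * (\<Prod>i\<in>UNIV. (v $ i) ^ Poly_Mapping.lookup m i)"
  by (subst eval_superset[of "{m}"]) auto

lemma eval_add [simp]: "eval (p + r) v = eval p v + eval r v"
proof -
  let ?S = "Poly_Mapping.keys p \<union> Poly_Mapping.keys r"
  have "finite ?S" "Poly_Mapping.keys (p + r) \<subseteq> ?S"
    using keys_add[of p r] by auto
  then show ?thesis
    by (simp add: eval_superset[of ?S] lookup_add distrib_right sum.distrib)
qed

lemma eval_mult [simp]: "eval (p * r) v = eval p v * eval r v"
proof (induction p rule: poly3_induct)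
  case (monomial m c)
  show ?case
    by (induction r rule: poly3_induct)
      (simp_all add: mult_single eval_single lookup_add power_add prod.distrib distrib_left)
qed (simp_all add: distrib_right)

lemma eval_const_poly [simp]: "eval (const_poly c) v = c"
  by (simp add: eval_single)

lemma eval_1 [simp]: "eval 1 v = 1"
  using eval_const_poly[of 1 v] by simp

lemma eval_Var [simp]: "eval (Var i) v = v $ i"
proof -
  have "(\<Prod>j\<in>UNIV. (v $ j) ^ Poly_Mapping.lookup (Poly_Mapping.single i 1) j)
    = (\<Prod>j\<in>UNIV. if j = i then v $ i else 1)"
    by (intro prod.cong) (auto simp: lookup_single)
  then show ?thesis by (simp add: Var_def eval_single)
qed

lemma eval_minus [simp]: "eval (- p) v = - eval p v"
  using eval_add[of p "-p" v] by (simp add: eq_neg_iff_add_eq_0 add.commute)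

lemma eval_diff [simp]: "eval (p - r) v = eval p v - eval r v"
  using eval_add[of p "-r" v] by simp

lemma eval_sum [simp]: "eval (sum f S) v = (\<Sum>i\<in>S. eval (f i) v)"
  by (induction S rule: infinite_finite_induct) auto

lemma eval_prod [simp]: "eval (prod f S) v = (\<Prod>i\<in>S. eval (f i) v)"
  by (induction S rule: infinite_finite_induct) auto

lemma eval_power [simp]: "eval (p ^ k) v = eval p v ^ k"
  by (induction k) auto

section \<open>Derivatives\<close>

lemma partial_deriv_superset:
  assumes "finite S" "Poly_Mapping.keys p \<subseteq> S"
  shows "partial_deriv i p = (\<Sum>m\<in>S. Poly_Mapping.single (m - Poly_Mapping.single i 1)
       (of_nat (Poly_Mapping.lookup m i) * Poly_Mapping.lookup p m))"
  unfolding partial_deriv_def using assms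
  by (intro sum.mono_neutral_left) (auto simp: in_keys_iff)

lemma partial_deriv_0 [simp]: "partial_deriv i 0 = 0"
  by (simp add: partial_deriv_def)

lemma partial_deriv_single: "partial_deriv i (Poly_Mapping.single m c) =
    Poly_Mapping.single (m - Poly_Mapping.single i 1) (of_nat (Poly_Mapping.lookup m i) * c)"
  by (subst partial_deriv_superset[of "{m}"]) auto

lemma partial_deriv_add [simp]: "partial_deriv i (p + r) = partial_deriv i p + partial_deriv i r"
proof -
  let ?S = "Poly_Mapping.keys p \<union> Poly_Mapping.keys r"
  have "finite ?S" "Poly_Mapping.keys (p + r) \<subseteq> ?S"
    using keys_add[of p r] by auto
  then show ?thesis
    by (simp add: partial_deriv_superset[of ?S] lookup_add distrib_left sum.distrib single_add)
qed

lemma partial_deriv_mult: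
  "partial_deriv i (p * r) = partial_deriv i p * r + p * partial_deriv i r"
proof (induction p rule: poly3_induct)
  case (monomial m c)
  show ?case
  proof (induction r rule: poly3_induct)
    case (monomial n e)
    let ?x = "Poly_Mapping.single i (1::nat)"
    have 1: "m + n - ?x = (m - ?x) + n" if "Poly_Mapping.lookup m i \<noteq> 0"
      using that by (intro poly_mapping_eqI) (auto simp: lookup_minus lookup_add lookup_single when_def)
    have 2: "m + n - ?x = m + (n - ?x)" if "Poly_Mapping.lookup n i \<noteq> 0"
      using that by (intro poly_mapping_eqI) (auto simp: lookup_minus lookup_add lookup_single when_def)
    show ?case
      using 1 2
      by (cases "Poly_Mapping.lookup m i = 0"; cases "Poly_Mapping.lookup n i = 0")
        (simp_all add: partial_deriv_single mult_single lookup_add algebra_simps flip: single_add)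
  qed (simp_all add: algebra_simps)
qed (simp_all add: algebra_simps)

lemma partial_deriv_const_poly [simp]: "partial_deriv i (const_poly c) = 0"
  by (simp add: partial_deriv_single)

lemma partial_deriv_Var [simp]: "partial_deriv i (Var j) = (if i = j then 1 else 0)"
  by (auto simp: Var_def partial_deriv_single lookup_single)

lemma partial_deriv_sum [simp]: "partial_deriv i (sum f S) = (\<Sum>j\<in>S. partial_deriv i (f j))"
  by (induction S rule: infinite_finite_induct) auto

definition dir_deriv :: "complex ^ 3 \<Rightarrow> poly3 \<Rightarrow> poly3" where
  "dir_deriv u p = (\<Sum>i\<in>UNIV. const_poly (u $ i) * partial_deriv i p)"

lemma dir_deriv_mult: "dir_deriv u (p * r) = dir_deriv u p * r + p * dir_deriv u r"
  by (simp add: dir_deriv_def partial_deriv_mult sum.distrib sum_distrib_left sum_distrib_right algebra_simps)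

lemma dir_deriv_add: "dir_deriv u (p + r) = dir_deriv u p + dir_deriv u r"
  by (simp add: dir_deriv_def sum.distrib algebra_simps)

lemma dir_deriv_const_poly [simp]: "dir_deriv u (const_poly c) = 0"
  by (simp add: dir_deriv_def)

section \<open>Forms of degree one and two\<close>

text \<open>Linear forms are handled through their coefficient vectors; \<open>dot\<close> is the bilinear (not the
  Hermitian) pairing of a coefficient vector with a point.\<close>

definition lin_form :: "complex ^ 3 \<Rightarrow> poly3" where
  "lin_form a = (\<Sum>i\<in>UNIV. const_poly (a $ i) * Var i)"

definition dot :: "complex ^ 3 \<Rightarrow> complex ^ 3 \<Rightarrow> complex" where
  "dot a v = (\<Sum>i\<in>UNIV. a $ i * v $ i)"

lemma eval_lin_form [simp]: "eval (lin_form a) v = dot a v"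
  by (simp add: lin_form_def dot_def)

lemma const_poly_sum: "const_poly (sum f S) = (\<Sum>i\<in>S. const_poly (f i))"
  by (induction S rule: infinite_finite_induct) (auto simp: single_add)

lemma const_poly_mult: "const_poly (c * e) = const_poly c * const_poly e"
  by (simp add: mult_single)

lemma partial_deriv_lin_form: "partial_deriv i (lin_form a) = const_poly (a $ i)"
proof -
  have "partial_deriv i (lin_form a) = (\<Sum>j\<in>UNIV. if i = j then const_poly (a $ j) else 0)"
    unfolding lin_form_def partial_deriv_sum by (intro sum.cong) (auto simp: partial_deriv_mult)
  then show ?thesis by simp
qed

lemma dir_deriv_lin_form [simp]: "dir_deriv u (lin_form a) = const_poly (dot a u)"
  unfolding dir_deriv_def partial_deriv_lin_form dot_def const_poly_sum
  by (intro sum.cong refl) (metis const_poly_mult mult.commute)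

lemma lin_form_0 [simp]: "lin_form 0 = 0"
  by (simp add: lin_form_def)

lemma zero_locus_lin_form: "zero_locus (lin_form a) = {v. v \<noteq> 0 \<and> dot a v = 0}"
  by (simp add: zero_locus_def)

lemma lin_form_add: "lin_form (a + b) = lin_form a + lin_form b"
  by (simp add: lin_form_def single_add distrib_right sum.distrib)

lemma lin_form_diff: "lin_form (a - b) = lin_form a - lin_form b"
  by (simp add: lin_form_def single_diff left_diff_distrib sum_subtractf)

lemma lin_form_scale: "lin_form (c *s a) = const_poly c * lin_form a"
  unfolding lin_form_def sum_distrib_left
  by (intro sum.cong refl) (simp only: vector_scalar_mult_def vec_lambda_beta const_poly_mult mult.assoc)

lemma lin_form_scaled: "s \<noteq> 0 \<Longrightarrow> lin_form a = const_poly (1 / s) * lin_form (s *s a)"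
  by (simp add: lin_form_scale flip: const_poly_mult mult.assoc)

lemma forms_0: "0 \<in> forms k"
  by (simp add: forms_def)

lemma forms_add: "p \<in> forms k \<Longrightarrow> r \<in> forms k \<Longrightarrow> p + r \<in> forms k"
  using keys_add[of p r] by (auto simp: forms_def)

lemma monom_degree_add: "monom_degree (m + n) = monom_degree m + monom_degree n"
  by (simp add: monom_degree_def lookup_add sum.distrib)

lemma forms_mult: "p \<in> forms k \<Longrightarrow> r \<in> forms n \<Longrightarrow> p * r \<in> forms (k + n)"
  using keys_mult[of p r] by (fastforce simp: forms_def monom_degree_add)

lemma forms_sum: "(\<And>i. i \<in> S \<Longrightarrow> f i \<in> forms k) \<Longrightarrow> sum f S \<in> forms k"
  by (induction S rule: infinite_finite_induct) (auto intro: forms_0 forms_add)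

lemma monom_degree_single: "monom_degree (Poly_Mapping.single i n) = n"
  by (simp add: monom_degree_def lookup_single when_def)

lemma const_poly_forms: "const_poly c \<in> forms 0"
  by (simp add: forms_def monom_degree_def)

lemma Var_forms: "Var i \<in> forms 1"
  by (simp add: forms_def Var_def monom_degree_single)

lemma lin_form_forms: "lin_form a \<in> forms 1"
  unfolding lin_form_def using forms_mult[OF const_poly_forms Var_forms] by (auto intro!: forms_sum)

lemma forms_0_eq: "p \<in> forms 0 \<Longrightarrow> \<exists>c. p = const_poly c"
proof -
  assume p: "p \<in> forms 0"
  have "m = 0" if "m \<in> Poly_Mapping.keys p" for m
    using p that by (intro poly_mapping_eqI) (auto simp: forms_def monom_degree_def)
  then have "p = const_poly (Poly_Mapping.lookup p 0)"
    by (intro poly_mapping_eqI) (auto simp: lookup_single when_def in_keys_iff)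
  then show ?thesis ..
qed

text \<open>Splitting off one variable gives every form of low degree an explicit shape by induction on
  the degree.\<close>

lemma forms_Suc_split:
  assumes "p \<in> forms (Suc k)"
  obtains r where "\<And>i. r i \<in> forms k" "p = (\<Sum>i\<in>UNIV. Var i * r i)"
proof -
  define G where "G = {p. \<exists>r. (\<forall>i. r i \<in> forms k) \<and> p = (\<Sum>i\<in>UNIV. Var i * r i)}"
  have 0: "0 \<in> G"
    unfolding G_def by (auto intro!: exI[of _ "\<lambda>_. 0"] forms_0)
  have add: "a + b \<in> G" if "a \<in> G" "b \<in> G" for a b
  proof -
    from that obtain r s where "\<forall>i. r i \<in> forms k" "a = (\<Sum>i\<in>UNIV. Var i * r i)"
      "\<forall>i. s i \<in> forms k" "b = (\<Sum>i\<in>UNIV. Var i * s i)"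
      unfolding G_def by auto
    then show ?thesis unfolding G_def
      by (auto intro!: exI[of _ "\<lambda>i. r i + s i"] forms_add simp: distrib_left sum.distrib)
  qed
  have mono: "Poly_Mapping.single m c \<in> G" if "monom_degree m = Suc k" for m c
  proof -
    have "\<exists>i. Poly_Mapping.lookup m i \<noteq> 0"
    proof (rule ccontr)
      assume "\<not> ?thesis"
      then have "monom_degree m = 0" by (simp add: monom_degree_def)
      then show False using that by simp
    qed
    then obtain i where i: "Poly_Mapping.lookup m i \<noteq> 0" ..
    define n where "n = m - Poly_Mapping.single i 1"
    have m: "m = Poly_Mapping.single i 1 + n"
      unfolding n_def using i
      by (intro poly_mapping_eqI) (auto simp: lookup_minus lookup_add lookup_single when_def)
    have n: "monom_degree n = k"
      using that by (simp add: m monom_degree_add monom_degree_single)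
    have "Poly_Mapping.single m c = (\<Sum>j\<in>UNIV. Var j * (if j = i then Poly_Mapping.single n c else 0))"
      by (simp add: if_distrib Var_def mult_single m cong: if_cong)
    then show ?thesis unfolding G_def
      using n by (auto intro!: exI[of _ "\<lambda>j. if j = i then Poly_Mapping.single n c else 0"] forms_0
          simp: forms_def split: if_splits)
  qed
  have "p = (\<Sum>m\<in>Poly_Mapping.keys p. Poly_Mapping.single m (Poly_Mapping.lookup p m))"
    by (intro poly_mapping_eqI) (auto simp: lookup_sum lookup_single when_def in_keys_iff)
  moreover have "(\<Sum>m\<in>S. Poly_Mapping.single m (Poly_Mapping.lookup p m)) \<in> G"
    if "finite S" "S \<subseteq> Poly_Mapping.keys p" for S
    using that by (induction S) (use assms in \<open>auto intro!: add mono 0 simp: forms_def\<close>)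
  ultimately have "p \<in> G" by (metis finite_keys order_refl)
  then show thesis using that unfolding G_def by auto
qed

lemma forms_1_eq_lin_form:
  assumes "p \<in> forms 1"
  obtains a where "p = lin_form a"
proof -
  obtain r where r: "\<And>i. r i \<in> forms 0" "p = (\<Sum>i\<in>UNIV. Var i * r i)"
    using forms_Suc_split[of p 0] assms by auto
  have "\<forall>i. \<exists>c. r i = const_poly c" using forms_0_eq r(1) by blast
  then obtain a where "\<forall>i. r i = const_poly (a i)" by (rule choice[THEN exE])
  then have "p = (\<Sum>i\<in>UNIV. Var i * const_poly (a i))" using r(2) by simp
  also have "\<dots> = lin_form (\<chi> i. a i)"
    unfolding lin_form_def by (intro sum.cong refl) (simp only: vec_lambda_beta mult.commute)
  finally have "p = lin_form (\<chi> i. a i)" .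
  then show thesis by (rule that)
qed

text \<open>The values at the unit vectors and at their pairwise sums determine the symmetrized
  coefficients of a quadratic form, so a nonzero form of degree 2 is a nonzero function.\<close>

lemma quadric_values_nonzero:
  assumes "p \<in> forms 2" "p \<noteq> 0"
  obtains M :: "3 \<Rightarrow> 3 \<Rightarrow> complex"
  where "\<And>v. eval p v = (\<Sum>i\<in>UNIV. \<Sum>j\<in>UNIV. M i j * v $ i * v $ j)" "\<exists>v. eval p v \<noteq> 0"
proof -
  obtain r where r: "\<And>i. r i \<in> forms 1" "p = (\<Sum>i\<in>UNIV. Var i * r i)"
    using forms_Suc_split[of p 1] assms by (auto simp: numeral_2_eq_2)
  have "\<forall>i. \<exists>a. r i = lin_form a" using forms_1_eq_lin_form r(1) by blast
  then obtain M' where "\<forall>i. r i = lin_form (M' i)" by (rule choice[THEN exE])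
  then have p: "p = (\<Sum>i\<in>UNIV. Var i * lin_form (M' i))" using r by simp
  have ev: "eval p v = (\<Sum>i\<in>UNIV. \<Sum>j\<in>UNIV. M' i $ j * v $ i * v $ j)" for v
    by (simp add: p dot_def sum_distrib_left mult_ac)
  have False if zero: "\<And>v. eval p v = 0"
  proof -
    have d: "M' i $ i = 0" for i
      using zero[of "axis i 1"] exhaust_3[of i] by (auto simp: ev sum_3 axis_def)
    have "M' 1 $ 2 + M' 2 $ 1 = 0" "M' 1 $ 3 + M' 3 $ 1 = 0" "M' 2 $ 3 + M' 3 $ 2 = 0"
      using zero[of "axis 1 1 + axis 2 1"] zero[of "axis 1 1 + axis 3 1"] zero[of "axis 2 1 + axis 3 1"]
      by (simp_all add: ev sum_3 axis_def d)
    then have "M' 2 $ 1 = - (M' 1 $ 2)" "M' 3 $ 1 = - (M' 1 $ 3)" "M' 3 $ 2 = - (M' 2 $ 3)"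
      by (simp_all add: eq_neg_iff_add_eq_0 add.commute)
    then have "p = Var 1 * (const_poly (M' 1 $ 2) * Var 2 + const_poly (M' 1 $ 3) * Var 3)
        + Var 2 * (- const_poly (M' 1 $ 2) * Var 1 + const_poly (M' 2 $ 3) * Var 3)
        + Var 3 * (- const_poly (M' 1 $ 3) * Var 1 - const_poly (M' 2 $ 3) * Var 2)"
      by (simp add: p lin_form_def sum_3 d single_uminus)
    also have "\<dots> = 0" by algebra
    finally have "p = 0" .
    then show False using assms by simp
  qed
  then have "\<exists>v. eval p v \<noteq> 0" by blast
  then show thesis by (rule that[of "\<lambda>i j. M' i $ j", OF ev])
qed

section \<open>Linear forms and their common zeros\<close>

text \<open>The bilinear cross product of two coefficient vectors is the intersection point of the two
  lines; of two points, it is the line through them.\<close>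

definition cross_prod :: "complex ^ 3 \<Rightarrow> complex ^ 3 \<Rightarrow> complex ^ 3" where
  "cross_prod a b = vector [a $ 2 * b $ 3 - a $ 3 * b $ 2, a $ 3 * b $ 1 - a $ 1 * b $ 3, a $ 1 * b $ 2 - a $ 2 * b $ 1]"

definition det3 :: "complex ^ 3 \<Rightarrow> complex ^ 3 \<Rightarrow> complex ^ 3 \<Rightarrow> complex" where
  "det3 a b c = dot (cross_prod a b) c"

lemmas vec3_simps = cross_prod_def det3_def dot_def sum_3 vector_3 vec_eq_iff forall_3

lemma dot_add [simp]: "dot (a + b) v = dot a v + dot b v"
  and dot_diff [simp]: "dot (a - b) v = dot a v - dot b v"
  and dot_scale [simp]: "dot (c *s a) v = c * dot a v"
  and dot_add_right [simp]: "dot a (u + v) = dot a u + dot a v"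
  and dot_scale_right [simp]: "dot a (c *s v) = c * dot a v"
  and dot_diff_right [simp]: "dot a (u - v) = dot a u - dot a v"
  by (simp_all add: dot_def sum_3 algebra_simps)

lemma dot_commute: "dot a b = dot b a"
  by (simp add: dot_def mult.commute)

lemma dot_cross_prod [simp]: "dot a (cross_prod a b) = 0" "dot b (cross_prod a b) = 0"
  by (simp_all add: vec3_simps algebra_simps)

lemma cross_prod_eq_0:
  assumes "cross_prod a b = 0" "a \<noteq> 0"
  obtains c where "b = c *s a"
proof -
  have e: "a $ 2 * b $ 3 = a $ 3 * b $ 2" "a $ 3 * b $ 1 = a $ 1 * b $ 3" "a $ 1 * b $ 2 = a $ 2 * b $ 1"
    using assms(1) by (simp_all add: vec3_simps)
  from assms(2) consider "a $ 1 \<noteq> 0" | "a $ 2 \<noteq> 0" | "a $ 3 \<noteq> 0"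
    by (auto simp: vec3_simps)
  then show thesis
  proof cases
    case 1
    then have "b = (b $ 1 / a $ 1) *s a" using e by (simp add: vec3_simps field_simps)
    then show thesis by (rule that)
  next
    case 2
    then have "b = (b $ 2 / a $ 2) *s a" using e by (simp add: vec3_simps field_simps)
    then show thesis by (rule that)
  next
    case 3
    then have "b = (b $ 3 / a $ 3) *s a" using e by (simp add: vec3_simps field_simps)
    then show thesis by (rule that)
  qed
qed

lemma ex_dot_1:
  assumes "z \<noteq> 0"
  obtains w where "dot z w = 1"
proof -
  from assms obtain i where i: "z $ i \<noteq> 0" by (auto simp: vec_eq_iff)
  have "dot z (axis i (1 / z $ i)) = 1"
    using i exhaust_3[of i] by (auto simp: dot_def sum_3 axis_def)
  then show thesis by (rule that)
qed

lemma cramer: "det3 a b c *s x = det3 x b c *s a + det3 a x c *s b + det3 a b x *s c"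
  by (simp add: vec3_simps algebra_simps)

text \<open>A line through the intersection of two others lies in their pencil: expand \<open>p\<close> by Cramer's
  rule in \<open>a\<close>, \<open>b\<close> and any third vector; its third coefficient is the vanishing determinant.\<close>

lemma in_pencil:
  assumes "cross_prod a b \<noteq> 0" "dot p (cross_prod a b) = 0"
  obtains r s where "p = r *s a + s *s b"
proof -
  obtain w where w: "dot (cross_prod a b) w = 1" using assms(1) ex_dot_1 by blast
  have "det3 a b w *s p = det3 p b w *s a + det3 a p w *s b + det3 a b p *s w"
    by (rule cramer)
  then have "p = det3 p b w *s a + det3 a p w *s b"
    using w assms(2) by (simp add: det3_def dot_commute)
  then show thesis by (rule that)
qed

lemma double_cross_prod: "cross_prod (cross_prod a b) v = dot a v *s b - dot b v *s a"
  by (simp add: vec3_simps algebra_simps)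

lemma common_zero:
  assumes "cross_prod a b \<noteq> 0" "dot a v = 0" "dot b v = 0"
  obtains c where "v = c *s cross_prod a b"
  using cross_prod_eq_0[of "cross_prod a b" v] assms double_cross_prod[of a b v] by auto

text \<open>Differentiating along \<open>u\<close> treats \<open>a\<close> and \<open>b\<close> as local coordinates at their intersection point
  and takes the partial derivative with respect to \<open>a\<close>.\<close>

lemma ex_dual:
  assumes "cross_prod a b \<noteq> 0"
  obtains u where "dot a u = 1" "dot b u = 0"
proof -
  obtain w where w: "dot (cross_prod a b) w = 1" using assms ex_dot_1 by blast
  have "dot a (cross_prod b w) = 1" "dot b (cross_prod b w) = 0"
    using w by (simp_all add: vec3_simps algebra_simps)
  then show thesis by (rule that)
qed

lemma cross_prod_commute: "cross_prod b a = - cross_prod a b"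
  by (simp add: vec3_simps)

lemma cross_prod_scale: "cross_prod (c *s a) b = c *s cross_prod a b"
  and cross_prod_self [simp]: "cross_prod a a = 0"
  by (simp_all add: vec3_simps algebra_simps)

section \<open>Ideals and saturation\<close>

lemma module_mult: "module ((*) :: 'a::comm_ring_1 \<Rightarrow> 'a \<Rightarrow> 'a)"
  by unfold_locales (simp_all add: algebra_simps)

lemma ideal_gen_base: "x \<in> B \<Longrightarrow> x \<in> ideal_gen B"
  and ideal_gen_0: "0 \<in> ideal_gen B"
  and ideal_gen_add: "x \<in> ideal_gen B \<Longrightarrow> y \<in> ideal_gen B \<Longrightarrow> x + y \<in> ideal_gen B"
  and ideal_gen_mult: "x \<in> ideal_gen B \<Longrightarrow> r * x \<in> ideal_gen B"
  for B :: "'a::comm_ring_1 set"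
  unfolding ideal_gen_def
  by (simp_all add: module.span_base module.span_zero module.span_add module.span_scale module_mult)

lemma ideal_gen_induct [consumes 1, case_names zero base add mult]:
  fixes B :: "'a::comm_ring_1 set"
  assumes "x \<in> ideal_gen B" "P 0" "\<And>x. x \<in> B \<Longrightarrow> P x" "\<And>x y. P x \<Longrightarrow> P y \<Longrightarrow> P (x + y)"
    "\<And>r x. P x \<Longrightarrow> P (r * x)"
  shows "P x"
proof -
  have "module.subspace (*) {x. P x}"
    by (rule module.subspaceI[OF module_mult]) (use assms in auto)
  then show ?thesis
    using module.span_induct[OF module_mult, of x B P] assms unfolding ideal_gen_def by blast
qed

lemma ideal_gen_3:
  fixes a b c :: "'a::comm_ring_1"
  assumes "x \<in> ideal_gen {a, b, c}"
  obtains r s t where "x = r * a + s * b + t * c"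
proof -
  have "\<exists>r s t. x = r * a + s * b + t * c"
    using assms
  proof (induction rule: ideal_gen_induct)
    case zero
    show ?case by (intro exI[of _ 0]) simp
  next
    case (base x)
    have "a = 1 * a + 0 * b + 0 * c" "b = 0 * a + 1 * b + 0 * c" "c = 0 * a + 0 * b + 1 * c" by simp_all
    then show ?case using base by blast
  next
    case (add x y)
    then obtain r s t r' s' t' where "x = r * a + s * b + t * c" "y = r' * a + s' * b + t' * c" by blast
    then have "x + y = (r + r') * a + (s + s') * b + (t + t') * c" by (simp add: algebra_simps)
    then show ?case by blast
  next
    case (mult k x)
    then obtain r s t where "x = r * a + s * b + t * c" by blast
    then have "k * x = (k * r) * a + (k * s) * b + (k * t) * c" by (simp add: algebra_simps)
    then show ?case by blast
  qed
  then show thesis using that by blast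
qed

text \<open>A power of an ideal is generated by products, so only products have to be tested.\<close>

lemma quotient_power_iff:
  fixes B :: "'a::comm_ring_1 set"
  shows "g \<in> ideal_quotient (ideal_gen B) (ideal_power M n) \<longleftrightarrow>
    (\<forall>a. (\<forall>i<n. a i \<in> M) \<longrightarrow> (\<Prod>i<n. a i) * g \<in> ideal_gen B)" (is "?L \<longleftrightarrow> ?R")
proof
  assume ?L
  moreover have "(\<Prod>i<n. a i) \<in> ideal_power M n" if "\<forall>i<n. a i \<in> M" for a
    unfolding ideal_power_def using that by (intro ideal_gen_base) auto
  ultimately show ?R unfolding ideal_quotient_def by auto
next
  assume R: ?R
  have "x * g \<in> ideal_gen B" if "x \<in> ideal_power M n" for x
    using that unfolding ideal_power_def
  proof (induction rule: ideal_gen_induct)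
    case (base x)
    then show ?case using R by auto
  qed (auto simp: distrib_right mult.assoc intro: ideal_gen_0 ideal_gen_add ideal_gen_mult)
  then show ?L unfolding ideal_quotient_def by auto
qed

lemma quotient_power_Suc:
  fixes B :: "'a::comm_ring_1 set"
  assumes "g \<in> ideal_quotient (ideal_gen B) (ideal_power M n)"
  shows "g \<in> ideal_quotient (ideal_gen B) (ideal_power M (Suc n))"
  unfolding quotient_power_iff
proof (intro allI impI)
  fix a assume "\<forall>i<Suc n. a i \<in> M"
  then have "(\<Prod>i<n. a i) * g \<in> ideal_gen B" using assms unfolding quotient_power_iff by auto
  from ideal_gen_mult[OF this, of "a n"] show "(\<Prod>i<Suc n. a i) * g \<in> ideal_gen B"
    by (simp add: mult_ac)
qed

lemma quotient_power_mono:
  fixes B :: "'a::comm_ring_1 set"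
  assumes "n \<le> k" "g \<in> ideal_quotient (ideal_gen B) (ideal_power M n)"
  shows "g \<in> ideal_quotient (ideal_gen B) (ideal_power M k)"
  using assms by (induction rule: dec_induct) (auto intro: quotient_power_Suc)

lemma saturation_iff:
  "g \<in> saturation J M \<longleftrightarrow> (\<exists>n. g \<in> ideal_quotient J (ideal_power M n))"
  by (auto simp: saturation_def)

lemma saturation_add:
  fixes B :: "'a::comm_ring_1 set"
  assumes "g \<in> saturation (ideal_gen B) M" "h \<in> saturation (ideal_gen B) M"
  shows "g + h \<in> saturation (ideal_gen B) M"
proof -
  obtain n k where "g \<in> ideal_quotient (ideal_gen B) (ideal_power M n)"
    "h \<in> ideal_quotient (ideal_gen B) (ideal_power M k)"
    using assms by (auto simp: saturation_iff)
  then have "g \<in> ideal_quotient (ideal_gen B) (ideal_power M (max n k))"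
    "h \<in> ideal_quotient (ideal_gen B) (ideal_power M (max n k))"
    by (auto intro: quotient_power_mono[rotated])
  then have "g + h \<in> ideal_quotient (ideal_gen B) (ideal_power M (max n k))"
    by (auto simp: ideal_quotient_def distrib_left intro: ideal_gen_add)
  then show ?thesis by (auto simp: saturation_iff)
qed

lemma saturation_mult:
  fixes B :: "'a::comm_ring_1 set"
  assumes "g \<in> saturation (ideal_gen B) M"
  shows "r * g \<in> saturation (ideal_gen B) M"
proof -
  from assms obtain n where "\<forall>a\<in>ideal_power M n. a * g \<in> ideal_gen B"
    by (auto simp: saturation_iff ideal_quotient_def)
  then have "\<forall>a\<in>ideal_power M n. a * (r * g) \<in> ideal_gen B"
    by (simp add: mult.left_commute[of _ r] ideal_gen_mult)
  then show ?thesis by (auto simp: saturation_iff ideal_quotient_def)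
qed

lemma saturation_superset:
  fixes B :: "'a::comm_ring_1 set"
  assumes "g \<in> ideal_gen B"
  shows "g \<in> saturation (ideal_gen B) M"
  using assms by (auto simp: saturation_iff ideal_quotient_def intro!: ideal_gen_mult)

text \<open>Saturating twice has no further effect. The three exponents that serve for the three
  variables are replaced by a common bound \<open>N\<close>; then \<open>N + 1\<close> factors from the maximal ideal suffice,
  the last one being used to produce a variable.\<close>

lemma saturation_if_Var:
  fixes w :: poly3
  assumes "\<And>i. Var i * w \<in> saturation (ideal_gen B) max_ideal"
  shows "w \<in> saturation (ideal_gen B) max_ideal"
proof -
  have "\<forall>i. \<exists>n. Var i * w \<in> ideal_quotient (ideal_gen B) (ideal_power max_ideal n)"
    using assms by (auto simp: saturation_iff)
  then obtain n where n: "\<And>i. Var i * w \<in> ideal_quotient (ideal_gen B) (ideal_power max_ideal (n i))"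
    by metis
  define N where "N = (\<Sum>i\<in>UNIV. n i)"
  have "n i \<le> N" for i unfolding N_def by (rule member_le_sum) auto
  then have N: "Var i * w \<in> ideal_quotient (ideal_gen B) (ideal_power max_ideal N)" for i
    using n quotient_power_mono by blast
  have "w \<in> ideal_quotient (ideal_gen B) (ideal_power max_ideal (Suc N))"
    unfolding quotient_power_iff
  proof (intro allI impI)
    fix a :: "nat \<Rightarrow> poly3" assume a: "\<forall>i<Suc N. a i \<in> max_ideal"
    let ?P = "\<Prod>i<N. a i"
    have P: "?P * (Var i * w) \<in> ideal_gen B" for i
      using N[of i] a unfolding quotient_power_iff by auto
    have "?P * (x * w) \<in> ideal_gen B" if "x \<in> max_ideal" for x
      using that unfolding max_ideal_def
    proof (induction rule: ideal_gen_induct)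
      case (mult r x)
      from ideal_gen_mult[OF this, of r] show ?case by (simp add: mult_ac)
    qed (use P in \<open>auto simp: distrib_left distrib_right intro: ideal_gen_0 ideal_gen_add\<close>)
    then show "(\<Prod>i<Suc N. a i) * w \<in> ideal_gen B"
      using a by (simp add: mult.assoc)
  qed
  then show ?thesis by (auto simp: saturation_iff)
qed

lemma Var_eq_lin_form: "Var i = lin_form (axis i 1)"
proof -
  have "lin_form (axis i 1) = (\<Sum>j\<in>UNIV. if j = i then Var j else 0)"
    unfolding lin_form_def by (intro sum.cong) (auto simp: axis_def)
  then show ?thesis by simp
qed

text \<open>Three independent linear forms generate the maximal ideal, so \<open>w\<close> lies in the saturation as
  soon as its products with powers of these forms do. Multiplying \<open>w\<close> by one of the forms lowers the
  exponent of that form, which reduces the claim to exponents equal to 1.\<close>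

lemma saturation_if_powers:
  fixes w :: poly3 and B :: "poly3 set"
  assumes "det3 a b c \<noteq> 0"
  defines "S \<equiv> saturation (ideal_gen B) max_ideal"
  shows "lin_form a ^ i * w \<in> S \<Longrightarrow> lin_form b ^ j * w \<in> S \<Longrightarrow> lin_form c ^ k * w \<in> S \<Longrightarrow> w \<in> S"
proof (induction "i + j + k" arbitrary: i j k w rule: less_induct)
  case less
  show ?case
  proof (cases "i = 0 \<or> j = 0 \<or> k = 0")
    case True
    then show ?thesis using less.prems by auto
  next
    case False
    then obtain i' j' k' where ijk: "i = Suc i'" "j = Suc j'" "k = Suc k'"
      by (meson not0_implies_Suc)
    have mult: "r * x \<in> S" if "x \<in> S" for r x
      using that saturation_mult unfolding S_def by blast
    have swap: "x * (r * w) \<in> S" if "x * w \<in> S" for r x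
      using mult[OF that, of r] by (simp add: mult_ac)
    have "lin_form a ^ i' * (lin_form a * w) \<in> S" "lin_form b ^ j' * (lin_form b * w) \<in> S" "lin_form c ^ k' * (lin_form c * w) \<in> S"
      using less.prems ijk by (simp_all add: mult_ac)
    then have abc: "lin_form a * w \<in> S" "lin_form b * w \<in> S" "lin_form c * w \<in> S"
      using less.hyps[of i' j k "lin_form a * w"] less.hyps[of i j' k "lin_form b * w"]
        less.hyps[of i j k' "lin_form c * w"] swap less.prems ijk by auto
    have "Var n * w \<in> S" for n
    proof -
      let ?x = "axis n 1 :: complex ^ 3"
      define d where "d = det3 a b c"
      have d: "d \<noteq> 0" using assms(1) d_def by simp
      have "const_poly d * lin_form ?x = lin_form (d *s ?x)" by (simp add: lin_form_scale)
      also have "d *s ?x = det3 ?x b c *s a + det3 a ?x c *s b + det3 a b ?x *s c"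
        unfolding d_def by (rule cramer)
      also have "lin_form \<dots> = const_poly (det3 ?x b c) * lin_form a + const_poly (det3 a ?x c) * lin_form b + const_poly (det3 a b ?x) * lin_form c"
        by (simp add: lin_form_add lin_form_scale)
      finally have "const_poly d * Var n * w = const_poly (det3 ?x b c) * (lin_form a * w)
          + const_poly (det3 a ?x c) * (lin_form b * w) + const_poly (det3 a b ?x) * (lin_form c * w)"
        by (simp add: Var_eq_lin_form algebra_simps)
      also have "\<dots> \<in> S"
        using mult abc unfolding S_def by (intro saturation_add) auto
      finally have "const_poly (1 / d) * (const_poly d * Var n * w) \<in> S" by (rule mult)
      moreover have "const_poly (1 / d) * const_poly d = 1" using d by (simp flip: const_poly_mult)
      ultimately show ?thesis by (simp flip: mult.assoc)
    qed
    then show ?thesis unfolding S_def by (rule saturation_if_Var)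
  qed
qed

section \<open>From local to global membership in the saturation\<close>

text \<open>This replaces the Nullstellensatz for line arrangements. Write \<open>w(T)\<close> for the squared product
  of the lines outside \<open>T\<close>. The hypothesis gives \<open>w(T) h \<in> S\<close> when \<open>T\<close> consists of all lines through
  a multiple point, hence whenever the lines of \<open>T\<close> are concurrent. If \<open>T\<close> contains three independent
  lines, then removing one of them multiplies \<open>w(T)\<close> by the square of its equation, so that the
  induction hypothesis supplies the three products required by the preceding lemma. The
  case \<open>T = I\<close> is the claim, because \<open>w(I) = 1\<close>.\<close>

lemma saturation_if_local:
  fixes g :: "'i \<Rightarrow> complex ^ 3" and h :: poly3 and B :: "poly3 set"
  defines "S \<equiv> saturation (ideal_gen B) max_ideal"
  assumes fin: "finite I" and two: "card I \<ge> 2"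
    and lines: "\<And>i j. i \<in> I \<Longrightarrow> j \<in> I \<Longrightarrow> i \<noteq> j \<Longrightarrow> cross_prod (g i) (g j) \<noteq> 0"
    and local: "\<And>N. N \<noteq> 0 \<Longrightarrow> card {i\<in>I. dot (g i) N = 0} \<ge> 2 \<Longrightarrow>
      (\<Prod>i\<in>{i\<in>I. dot (g i) N \<noteq> 0}. lin_form (g i))\<^sup>2 * h \<in> S"
  shows "h \<in> S"
proof -
  have mult: "r * x \<in> S" if "x \<in> S" for r x
    using that saturation_mult unfolding S_def by blast
  have pencil: "(\<Prod>i\<in>I - T. lin_form (g i))\<^sup>2 * h \<in> S"
    if T: "T \<subseteq> I" "\<And>i. i \<in> T \<Longrightarrow> dot (g i) N = 0"
      and ij: "i \<in> I" "j \<in> I" "i \<noteq> j" "dot (g i) N = 0" "dot (g j) N = 0" and N: "N \<noteq> 0" for T N i j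
  proof -
    let ?U = "{i\<in>I. dot (g i) N = 0}" and ?V = "{i\<in>I. dot (g i) N \<noteq> 0}"
    have "card {i, j} \<le> card ?U" using fin ij by (intro card_mono) auto
    then have V: "(\<Prod>i\<in>?V. lin_form (g i))\<^sup>2 * h \<in> S" using ij by (intro local N) auto
    have "I - T = ?V \<union> (?U - T)" using T by auto
    then have "(\<Prod>i\<in>I - T. lin_form (g i)) = (\<Prod>i\<in>?V. lin_form (g i)) * (\<Prod>i\<in>?U - T. lin_form (g i))"
      using fin by (auto intro!: prod.union_disjoint)
    then show ?thesis
      using mult[OF V, of "(\<Prod>i\<in>?U - T. lin_form (g i))\<^sup>2"] by (simp add: power_mult_distrib mult_ac)
  qed
  have "(\<Prod>i\<in>I - T. lin_form (g i))\<^sup>2 * h \<in> S" if "T \<subseteq> I" for T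
    using that
  proof (induction "card T" arbitrary: T rule: less_induct)
    case less
    have finT: "finite T" using less.prems fin finite_subset by blast
    \<comment> \<open>Two lines whose intersection \<open>N\<close> is the only candidate for a common point of \<open>T\<close>.\<close>
    obtain a b where ab: "a \<in> I" "b \<in> I" "a \<noteq> b" "T \<subseteq> {a, b} \<or> {a, b} \<subseteq> T"
    proof (cases "card T \<ge> 2")
      case True
      then obtain U where "U \<subseteq> T" "card U = 2" using obtain_subset_with_card_n by metis
      then obtain a b where "a \<noteq> b" "{a, b} \<subseteq> T" by (auto simp: card_2_iff)
      then show thesis using that[of a b] less.prems by auto
    next
      case False
      then obtain a where a: "T \<subseteq> {a}"
        using finT by (cases "T = {}") (auto simp: not_le less_2_cases_iff card_1_singleton_iff)
      obtain U where "U \<subseteq> I" "card U = 2" using two obtain_subset_with_card_n by metis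
      then obtain b c where bc: "b \<in> I" "c \<in> I" "b \<noteq> c" by (auto simp: card_2_iff)
      show thesis
      proof (cases "T = {}")
        case True
        then show ?thesis using that[of b c] bc by auto
      next
        case False
        then have "T = {a}" "a \<in> I" using a less.prems by auto
        then show ?thesis using that[of a b] that[of a c] bc by auto
      qed
    qed
    define N where "N = cross_prod (g a) (g b)"
    have N: "N \<noteq> 0" using lines ab unfolding N_def by blast
    have Nab: "dot (g a) N = 0" "dot (g b) N = 0" unfolding N_def by simp_all
    show ?case
    proof (cases "\<forall>i\<in>T. dot (g i) N = 0")
      case True
      then show ?thesis using pencil[OF less.prems _ ab(1-3) Nab N] by blast
    next
      case False
      then obtain c where c: "c \<in> T" "dot (g c) N \<noteq> 0" by blast
      then have abT: "a \<in> T" "b \<in> T" using ab Nab by auto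
      have step: "lin_form (g i) ^ 2 * ((\<Prod>i\<in>I - T. lin_form (g i))\<^sup>2 * h) \<in> S" if i: "i \<in> T" for i
      proof -
        have "card (T - {i}) < card T" using i finT by (metis card_Diff1_less)
        then have "(\<Prod>i\<in>I - (T - {i}). lin_form (g i))\<^sup>2 * h \<in> S"
          using less.prems by (intro less.hyps) auto
        moreover have "I - (T - {i}) = insert i (I - T)" using i less.prems by auto
        ultimately show ?thesis using fin i by (simp add: power_mult_distrib mult_ac)
      qed
      have "det3 (g a) (g b) (g c) \<noteq> 0"
        using c by (simp add: det3_def N_def dot_commute)
      then show ?thesis
        using step[OF abT(1)] step[OF abT(2)] step[OF c(1)] unfolding S_def
        by (rule saturation_if_powers)
    qed
  qed
  from this[of I] show ?thesis by simp
qed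

section \<open>Local membership at double and triple points\<close>

lemma dir_deriv_in_jacobian: "dir_deriv u f \<in> jacobian_ideal f"
  unfolding dir_deriv_def jacobian_ideal_def UNIV_3
  by (auto intro!: ideal_gen_add ideal_gen_mult intro: ideal_gen_base)

text \<open>Euler's formula, in the one case that puts \<open>f\<close> into its own Jacobian ideal.\<close>

lemma euler_prod_lin_form:
  assumes "finite I"
  shows "(\<Sum>k\<in>UNIV. Var k * partial_deriv k (\<Prod>i\<in>I. lin_form (g i))) = of_nat (card I) * (\<Prod>i\<in>I. lin_form (g i))"
  using assms
proof (induction I rule: finite_induct)
  case empty
  have "partial_deriv k 1 = 0" for k using partial_deriv_const_poly[of k 1] by simp
  then show ?case by simp
next
  case (insert j I)
  let ?p = "\<Prod>i\<in>I. lin_form (g i)"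
  have "(\<Sum>k\<in>UNIV. Var k * partial_deriv k (lin_form (g j) * ?p))
      = (\<Sum>k\<in>UNIV. const_poly (g j $ k) * Var k) * ?p + lin_form (g j) * (\<Sum>k\<in>UNIV. Var k * partial_deriv k ?p)"
    by (simp add: partial_deriv_mult partial_deriv_lin_form sum.distrib sum_distrib_left sum_distrib_right
        distrib_left mult_ac)
  also have "\<dots> = lin_form (g j) * ?p + lin_form (g j) * (of_nat (card I) * ?p)"
    unfolding insert.IH by (simp add: lin_form_def)
  finally show ?case using insert.hyps by (simp add: algebra_simps)
qed

lemma prod_lin_form_in_jacobian:
  assumes "finite I" "I \<noteq> {}"
  shows "(\<Prod>i\<in>I. lin_form (g i)) \<in> jacobian_ideal (\<Prod>i\<in>I. lin_form (g i))" (is "?f \<in> _")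
proof -
  let ?n = "of_nat (card I) :: complex"
  have n: "?n \<noteq> 0" using assms by simp
  have "(\<Sum>k\<in>UNIV. Var k * partial_deriv k ?f) \<in> jacobian_ideal ?f"
    unfolding jacobian_ideal_def UNIV_3
    by (auto intro!: ideal_gen_add ideal_gen_mult intro: ideal_gen_base)
  then have "const_poly (1 / ?n) * (of_nat (card I) * ?f) \<in> jacobian_ideal ?f"
    unfolding euler_prod_lin_form[OF assms(1)] unfolding jacobian_ideal_def by (rule ideal_gen_mult)
  moreover have "const_poly (1 / ?n) * of_nat (card I) = 1"
  proof -
    have "const_poly (1 / ?n) * const_poly ?n = 1" unfolding const_poly_mult[symmetric] using n by (simp del: single_of_nat)
    then show ?thesis unfolding single_of_nat .
  qed
  ultimately show ?thesis by (simp flip: mult.assoc)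
qed

text \<open>Locally the Jacobian ideal at a node is the maximal ideal \<open>(a, b)\<close>: the derivative of \<open>a b g\<close>
  dual to \<open>a\<close> is \<open>b g + a b g'\<close>, and multiplying by \<open>g\<close> turns the second summand into a multiple
  of \<open>f\<close>. The factor \<open>g\<close> does not vanish at the node.\<close>

lemma jacobian_at_double_point:
  assumes f: "f = lin_form a * lin_form b * g" "f \<in> jacobian_ideal f" and ab: "cross_prod a b \<noteq> 0"
    and h: "h = r * lin_form a + s * lin_form b"
  shows "g\<^sup>2 * h \<in> jacobian_ideal f"
proof -
  let ?J = "jacobian_ideal f"
  have mult: "t * x \<in> ?J" if "x \<in> ?J" for t x
    using that unfolding jacobian_ideal_def by (rule ideal_gen_mult)
  have add: "x + y \<in> ?J" if "x \<in> ?J" "y \<in> ?J" for x y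
    using that unfolding jacobian_ideal_def by (rule ideal_gen_add)
  have branch: "g\<^sup>2 * lin_form b' \<in> ?J" if ab': "cross_prod a' b' \<noteq> 0" and f': "f = lin_form a' * lin_form b' * g" for a' b'
  proof -
    obtain u where u: "dot a' u = 1" "dot b' u = 0" using ab' by (rule ex_dual)
    have "dir_deriv u f = lin_form b' * g + lin_form a' * lin_form b' * dir_deriv u g"
      unfolding f' by (simp add: dir_deriv_mult u algebra_simps)
    then have "g\<^sup>2 * lin_form b' = g * dir_deriv u f + (- dir_deriv u g) * f"
      unfolding f' by (simp add: power2_eq_square algebra_simps)
    then show ?thesis using add mult dir_deriv_in_jacobian f(2) by metis
  qed
  have "g\<^sup>2 * lin_form b \<in> ?J" using ab f(1) by (intro branch)
  moreover have "g\<^sup>2 * lin_form a \<in> ?J"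
    using ab f(1) by (intro branch[of b]) (simp_all add: mult_ac cross_prod_commute[of b a])
  ultimately have "r * (g\<^sup>2 * lin_form a) + s * (g\<^sup>2 * lin_form b) \<in> ?J"
    using add mult by blast
  then show ?thesis unfolding h by (simp add: algebra_simps)
qed

text \<open>At the triple point with local equation \<open>c = x y (x - y)\<close> the Jacobian ideal is
  \<open>(c\<^sub>x, c\<^sub>y)\<close> with \<open>c\<^sub>x = 2 x y - y\<^sup>2\<close> and \<open>c\<^sub>y = x\<^sup>2 - 2 x y\<close>. It contains all cubics in
  \<open>x\<close>, \<open>y\<close>, but only a two-dimensional space of quadrics, among them
  \<open>c\<^sub>x + c\<^sub>y = (x - y) (x + y)\<close>. Thus \<open>(x - y) q\<close> is locally in the ideal if the linear part of \<open>q\<close> is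
  a multiple of \<open>x + y\<close>, the harmonic conjugate of \<open>x - y\<close> with respect to \<open>x\<close> and \<open>y\<close>. The last factor
  of \<open>h\<close> is a \<open>q\<close> of this kind, with linear part \<open>t e (x + y)\<close>.\<close>

lemma jacobian_at_triple_point:
  assumes f: "f = const_poly \<kappa> * lin_form a * lin_form b * (lin_form a - lin_form b) * g" "f \<in> jacobian_ideal f"
    and \<kappa>: "\<kappa> \<noteq> 0" and ab: "cross_prod a b \<noteq> 0"
    and h: "h = r * (lin_form a - lin_form b) * (lin_form a * lin_form b * s + t * (e * (lin_form a + lin_form b) - (lin_form a)\<^sup>2 - (lin_form b)\<^sup>2))"
  shows "g\<^sup>2 * h \<in> jacobian_ideal f"
proof -
  let ?J = "jacobian_ideal f"
  have mult: "t * x \<in> ?J" if "x \<in> ?J" for t x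
    using that unfolding jacobian_ideal_def by (rule ideal_gen_mult)
  have add: "x + y \<in> ?J" if "x \<in> ?J" "y \<in> ?J" for x y
    using that unfolding jacobian_ideal_def by (rule ideal_gen_add)
  define x y k where "x = lin_form a" and "y = lin_form b" and "k = const_poly \<kappa>"
  define k' where "k' = const_poly (1 / \<kappa>)"
  have kk: "k' * k = 1" using \<kappa> unfolding k_def k'_def by (simp flip: const_poly_mult)
  have f': "f = k * x * y * (x - y) * g" using f x_def y_def k_def by simp
  have dk: "dir_deriv u k = 0" for u by (simp add: k_def)
  have minus: "dir_deriv u (p - q) = dir_deriv u p - dir_deriv u q" for u p q
    using dir_deriv_add[of u "p - q" q] by (simp add: algebra_simps)
  obtain u where u: "dot a u = 1" "dot b u = 0" using ab by (rule ex_dual)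
  obtain v where v: "dot b v = 1" "dot a v = 0"
    using ab by (metis ex_dual cross_prod_commute neg_equal_0_iff_equal)
  have du: "dir_deriv u x = 1" "dir_deriv u y = 0" "dir_deriv v x = 0" "dir_deriv v y = 1"
    using u v by (simp_all add: x_def y_def)
  have "g\<^sup>2 * (2 * x * y - y\<^sup>2) = k' * k * g\<^sup>2 * (2 * x * y - y\<^sup>2)" using kk by simp
  also have "\<dots> = (k' * g) * dir_deriv u f + (- (k' * dir_deriv u g)) * f"
    unfolding f' by (simp add: dir_deriv_mult minus dk du power2_eq_square algebra_simps)
  also have "\<dots> \<in> ?J" by (intro add mult dir_deriv_in_jacobian f(2))
  finally have P: "g\<^sup>2 * (2 * x * y - y\<^sup>2) \<in> ?J" .
  have "g\<^sup>2 * (x\<^sup>2 - 2 * x * y) = k' * k * g\<^sup>2 * (x\<^sup>2 - 2 * x * y)" using kk by simp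
  also have "\<dots> = (k' * g) * dir_deriv v f + (- (k' * dir_deriv v g)) * f"
    unfolding f' by (simp add: dir_deriv_mult minus dk du power2_eq_square algebra_simps)
  also have "\<dots> \<in> ?J" by (intro add mult dir_deriv_in_jacobian f(2))
  finally have Q: "g\<^sup>2 * (x\<^sup>2 - 2 * x * y) \<in> ?J" .
  have "g\<^sup>2 * (x * y * (x - y)) = k' * k * g\<^sup>2 * (x * y * (x - y))" using kk by simp
  also have "\<dots> = (k' * g) * f" unfolding f' by (simp add: power2_eq_square algebra_simps)
  also have "\<dots> \<in> ?J" by (intro mult f(2))
  finally have C: "g\<^sup>2 * (x * y * (x - y)) \<in> ?J" .
  have "g\<^sup>2 * h = (r * s - r * t) * (g\<^sup>2 * (x * y * (x - y)))
      + (r * t * (e - y)) * (g\<^sup>2 * (2 * x * y - y\<^sup>2)) + (r * t * (e - x)) * (g\<^sup>2 * (x\<^sup>2 - 2 * x * y))"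
    unfolding h x_def[symmetric] y_def[symmetric] by algebra
  also have "\<dots> \<in> ?J" by (intro add mult P Q C)
  finally show ?thesis .
qed

section \<open>Index calculus for the hexagon\<close>

lemma UNIV_6: "(UNIV :: 6 set) = {0, 1, 2, 3, 4, 5}"
proof -
  have "card {0, 1, 2, 3, 4, 5 :: 6} = CARD(6)" by simp
  then show ?thesis using card_subset_eq[of UNIV "{0, 1, 2, 3, 4, 5 :: 6}"] by simp
qed

lemma num_6: "(6 :: 6) = 0" "(7 :: 6) = 1" "(8 :: 6) = 2"
  by simp_all

lemma forall_6: "(\<forall>j::6. P j) \<longleftrightarrow> P 0 \<and> P 1 \<and> P 2 \<and> P 3 \<and> P 4 \<and> P 5"
  using UNIV_6 by (metis UNIV_I emptyE insertE)

text \<open>Two sides are adjacent, alternate or opposite; they meet in a vertex, in a point that belongs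
  to the quartic, and in a point of the Pascal line respectively.\<close>

lemma pairs_of_sides:
  assumes "i \<noteq> (j :: 6)"
  shows "j = i + 1 \<or> i = j + 1 \<or> j = i + 2 \<or> i = j + 2 \<or> j = i + 3"
proof -
  have "\<forall>i j. i \<noteq> (j :: 6) \<longrightarrow> j = i + 1 \<or> i = j + 1 \<or> j = i + 2 \<or> i = j + 2 \<or> j = i + 3"
    unfolding forall_6 by simp
  then show ?thesis using assms by blast
qed

text \<open>\<open>Inl j\<close> stands for the \<open>j\<close>-th side and \<open>Inr k\<close>, for \<open>k = 1, 2, 3\<close>, for the \<open>k\<close>-th diagonal.\<close>

definition line_index :: "(6 + 6) set" where
  "line_index = Inl ` UNIV \<union> Inr ` {1, 2, 3}"

lemma card_line_index: "card line_index = 9"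
proof -
  have "card line_index = card (range (Inl :: 6 \<Rightarrow> 6 + 6)) + card (Inr ` {1, 2, 3 :: 6} :: (6 + 6) set)"
    unfolding line_index_def by (rule card_Un_disjoint) auto
  also have "\<dots> = 9" by (simp add: card_image)
  finally show ?thesis .
qed

lemma prod_line_index: "(\<Prod>a\<in>line_index. g a) = (\<Prod>j\<in>UNIV. g (Inl j)) * (g (Inr 1) * g (Inr 2) * g (Inr 3))"
  for g :: "_ \<Rightarrow> 'a::comm_ring_1"
proof -
  have "(\<Prod>a\<in>line_index. g a) = (\<Prod>a\<in>range Inl. g a) * (\<Prod>a\<in>Inr ` {1, 2, 3}. g a)"
    unfolding line_index_def by (rule prod.union_disjoint) auto
  also have "(\<Prod>a\<in>range Inl. g a) = (\<Prod>j\<in>UNIV. g (Inl j))"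
    by (subst prod.reindex) auto
  also have "(\<Prod>a\<in>Inr ` {1, 2, 3}. g a) = g (Inr 1) * g (Inr 2) * g (Inr 3)"
    by (simp add: mult.assoc)
  finally show ?thesis .
qed

text \<open>Opposite vertices share a diagonal, so the indices 4, 5 and 0 are moved to 1, 2 and 3.\<close>

definition diag_index :: "6 \<Rightarrow> 6" where
  "diag_index j = (if j \<in> {1, 2, 3} then j else j + 3)"

section \<open>Hexagonal arrangements\<close>

text \<open>The hypotheses on the arrangement in terms of coefficient vectors: \<open>A\<close> vertices, \<open>L\<close> sides,
  \<open>D\<close> diagonals. Concurrency is counted on indices, which is the same as counting lines because
  distinct indices give distinct lines.\<close>

locale hexagon_lines =
  fixes A L D :: "6 \<Rightarrow> complex ^ 3"
  assumes vertices_distinct: "i \<noteq> j \<Longrightarrow> cross_prod (A i) (A j) \<noteq> 0"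
    and side_vertices: "dot (L j) (A j) = 0" "dot (L j) (A (j + 1)) = 0"
    and diagonal_vertices: "k \<in> {1, 2, 3} \<Longrightarrow> dot (D k) (A k) = 0"
      "k \<in> {1, 2, 3} \<Longrightarrow> dot (D k) (A (k + 3)) = 0"
    and lines_distinct: "a \<in> line_index \<Longrightarrow> b \<in> line_index \<Longrightarrow> a \<noteq> b \<Longrightarrow>
      cross_prod (case_sum L D a) (case_sum L D b) \<noteq> 0"
    and mult_le_3: "P \<noteq> 0 \<Longrightarrow> card {a \<in> line_index. dot (case_sum L D a) P = 0} \<le> 3"
    and triple_iff: "P \<noteq> 0 \<Longrightarrow> card {a \<in> line_index. dot (case_sum L D a) P = 0} = 3 \<longleftrightarrow>
      (\<exists>j c. c \<noteq> 0 \<and> P = c *s A j)"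
begin

lemma vertex_nonzero: "A j \<noteq> 0"
  using vertices_distinct[of j "j + 1"] by (auto simp: cross_prod_def vec3_simps)

lemma finite_line_index: "finite line_index"
  by (simp add: line_index_def)

lemma side_prev_vertex: "dot (L (j - 1)) (A j) = 0"
  using side_vertices(2)[of "j - 1"] by simp

lemma diag_in: "diag_index j \<in> {1, 2, 3}"
proof -
  have "\<forall>j. diag_index j \<in> {1, 2, 3}" unfolding forall_6 by (simp add: diag_index_def)
  then show ?thesis ..
qed

lemma diag_vertex: "dot (D (diag_index j)) (A j) = 0" "dot (D (diag_index j)) (A (j + 3)) = 0"
proof -
  have "\<forall>j. dot (D (diag_index j)) (A j) = 0 \<and> dot (D (diag_index j)) (A (j + 3)) = 0"
    using diagonal_vertices[of 1] diagonal_vertices[of 2] diagonal_vertices[of 3]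
    unfolding forall_6 by (simp add: diag_index_def num_6)
  then show "dot (D (diag_index j)) (A j) = 0" "dot (D (diag_index j)) (A (j + 3)) = 0" by auto
qed

lemma diag_in_index: "Inr (diag_index j) \<in> line_index"
  unfolding line_index_def using diag_in by (intro UnI2 imageI)

lemma lines_at_vertex:
  assumes "c \<noteq> 0"
  shows "{a \<in> line_index. dot (case_sum L D a) (c *s A j) = 0} = {Inl j, Inl (j - 1), Inr (diag_index j)}"
proof -
  let ?T = "{a \<in> line_index. dot (case_sum L D a) (c *s A j) = 0}"
  have "card ?T = 3" using assms vertex_nonzero by (subst triple_iff) auto
  moreover have "{Inl j, Inl (j - 1), Inr (diag_index j)} \<subseteq> ?T"
    using side_vertices side_prev_vertex diag_vertex diag_in_index by (auto simp: line_index_def)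
  moreover have "card {Inl j, Inl (j - 1), Inr (diag_index j) :: 6 + 6} = 3" by simp
  ultimately show ?thesis
    using card_subset_eq[of ?T "{Inl j, Inl (j - 1), Inr (diag_index j)}"] finite_line_index by simp
qed

text \<open>Three concurrent lines leave no room for a fourth, so they are the two sides and the
  diagonal at some vertex. All exclusions of coincidences below come from this shape, in particular
  that three sides or three diagonals never meet.\<close>

lemma three_lines_vertex:
  assumes "P \<noteq> 0" "T \<subseteq> line_index" "card T = 3" "\<And>a. a \<in> T \<Longrightarrow> dot (case_sum L D a) P = 0"
  obtains j where "T = {Inl j, Inl (j - 1), Inr (diag_index j)}"
proof -
  let ?T = "{a \<in> line_index. dot (case_sum L D a) P = 0}"
  have sub: "T \<subseteq> ?T" using assms by auto
  have fin: "finite ?T" using finite_line_index by simp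
  have "card ?T = 3" using card_mono[OF fin sub] mult_le_3[OF assms(1)] assms(3) by simp
  moreover from this have "T = ?T" using card_subset_eq[OF fin sub] assms(3) by simp
  ultimately show thesis using triple_iff[OF assms(1)] lines_at_vertex that by auto
qed

lemma sides_not_concurrent:
  assumes "P \<noteq> 0" "distinct [i, j, k]" "dot (L i) P = 0" "dot (L j) P = 0"
  shows "dot (L k) P \<noteq> 0"
proof
  assume "dot (L k) P = 0"
  then obtain m where "{Inl i, Inl j, Inl k} = {Inl m, Inl (m - 1), Inr (diag_index m) :: 6 + 6}"
    using assms by (auto intro: three_lines_vertex[of P "{Inl i, Inl j, Inl k}"] simp: line_index_def)
  then show False by blast
qed

lemma sides_independent: "i \<noteq> j \<Longrightarrow> cross_prod (L i) (L j) \<noteq> 0"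
  using lines_distinct[of "Inl i" "Inl j"] by (simp add: line_index_def)

lemma sides_det_nonzero:
  assumes "distinct [i, j, k]"
  shows "det3 (L i) (L j) (L k) \<noteq> 0"
  using sides_not_concurrent[OF sides_independent assms] assms
  by (simp add: det3_def dot_commute)

lemma side_vertex_nonzero:
  assumes "i \<noteq> j" "i \<noteq> j - 1"
  shows "dot (L i) (A j) \<noteq> 0"
  using sides_not_concurrent[OF vertex_nonzero _ side_vertices(1) side_prev_vertex, of j i] assms by simp

end

section \<open>Pascal's theorem as a normalization of the sides\<close>

text \<open>A conic meets a side \<open>x = 0\<close> of the coordinate triangle in two points; by Vieta the product of
  their ratios \<open>y / z\<close> is the quotient of two diagonal coefficients of the conic. Multiplying the three
  relations of the triangle gives Carnot's theorem.\<close>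

lemma carnot_edge:
  fixes q r s y y' z z' :: complex
  assumes "q * y\<^sup>2 + r * z\<^sup>2 + s * y * z = 0" "q * y'\<^sup>2 + r * z'\<^sup>2 + s * y' * z' = 0" "y * z' \<noteq> y' * z"
  shows "q * y * y' = r * z * z'"
proof -
  have "(y * z' - y' * z) * (q * y * y' - r * z * z') = 0"
    using assms(1,2) by algebra
  then show ?thesis using assms(3) by simp
qed

context hexagon_lines
begin

text \<open>Pascal's theorem in the form needed here: opposite sides can be scaled so that their sums all
  equal one form \<open>E\<close>, the Pascal line. Take the odd sides as coordinate triangle. The form \<open>E\<close> lies in the
  pencil of an even side \<open>L j\<close> and the opposite odd side \<open>L (j + 3)\<close> exactly when \<open>L j\<close> and \<open>E\<close> have
  proportional coefficients at the other two odd sides. These are three conditions on the two ratios between the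
  coefficients of \<open>E\<close>, and they are compatible by Carnot's theorem for the six points on the
  conic.\<close>

lemma pascal:
  assumes conic: "\<And>v. Q v = (\<Sum>i\<in>UNIV. \<Sum>j\<in>UNIV. M i j * v $ i * v $ j)"
    and nonzero: "Q v \<noteq> (0::complex)" and on_conic: "\<And>j. Q (A j) = 0"
  obtains s E where "\<And>j. s j \<noteq> 0" "\<And>j. s j *s L j + s (j + 3) *s L (j + 3) = E"
proof -
  define X Y Z where "X = dot (L 1)" and "Y = dot (L 3)" and "Z = dot (L 5)"
  define t where "t = det3 (L 1) (L 3) (L 5)"
  have t: "t \<noteq> 0" unfolding t_def by (rule sides_det_nonzero) simp
  \<comment> \<open>The vertices of the coordinate triangle: \<open>v\<close> has coordinates \<open>X v\<close>, \<open>Y v\<close>, \<open>Z v\<close> up to the factor \<open>t\<close>.\<close>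
  define U1 U3 U5 where "U1 = cross_prod (L 3) (L 5)" and "U3 = cross_prod (L 5) (L 1)" and "U5 = cross_prod (L 1) (L 3)"
  have tv: "t *s v = X v *s U1 + Y v *s U3 + Z v *s U5" for v
    by (simp add: t_def X_def Y_def Z_def U1_def U3_def U5_def vec3_simps algebra_simps)
  define bil where "bil u v = (\<Sum>i\<in>UNIV. \<Sum>j\<in>UNIV. M i j * u $ i * v $ j)" for u v :: "complex ^ 3"
  define q1 q3 q5 q13 q15 q35 where "q1 = Q U1" and "q3 = Q U3" and "q5 = Q U5"
    and "q13 = bil U1 U3 + bil U3 U1" and "q15 = bil U1 U5 + bil U5 U1" and "q35 = bil U3 U5 + bil U5 U3"
  have Qt: "t\<^sup>2 * Q v = q1 * (X v)\<^sup>2 + q3 * (Y v)\<^sup>2 + q5 * (Z v)\<^sup>2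
      + q13 * X v * Y v + q15 * X v * Z v + q35 * Y v * Z v" for v
  proof -
    have "t\<^sup>2 * Q v = Q (t *s v)"
      by (simp add: conic sum_distrib_left power2_eq_square mult_ac)
    also have "\<dots> = q1 * (X v)\<^sup>2 + q3 * (Y v)\<^sup>2 + q5 * (Z v)\<^sup>2
      + q13 * X v * Y v + q15 * X v * Z v + q35 * Y v * Z v"
      unfolding tv conic q1_def q3_def q5_def q13_def q15_def q35_def bil_def
      by (simp add: sum_3 algebra_simps power2_eq_square)
    finally show ?thesis .
  qed
  have QA: "q1 * (X (A j))\<^sup>2 + q3 * (Y (A j))\<^sup>2 + q5 * (Z (A j))\<^sup>2
      + q13 * X (A j) * Y (A j) + q15 * X (A j) * Z (A j) + q35 * Y (A j) * Z (A j) = 0" for j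
    using Qt[of "A j"] on_conic by simp
  have zero: "X (A 1) = 0" "X (A 2) = 0" "Y (A 3) = 0" "Y (A 4) = 0" "Z (A 5) = 0" "Z (A 0) = 0"
    using side_vertices(1)[of 1] side_vertices(2)[of 1] side_vertices(1)[of 3] side_vertices(2)[of 3]
      side_vertices(1)[of 5] side_vertices(2)[of 5] by (simp_all add: X_def Y_def Z_def num_6)
  have X: "X (A 3) \<noteq> 0" "X (A 4) \<noteq> 0" "X (A 5) \<noteq> 0" "X (A 0) \<noteq> 0"
    and Y: "Y (A 1) \<noteq> 0" "Y (A 2) \<noteq> 0" "Y (A 5) \<noteq> 0" "Y (A 0) \<noteq> 0"
    and Z: "Z (A 1) \<noteq> 0" "Z (A 2) \<noteq> 0" "Z (A 3) \<noteq> 0" "Z (A 4) \<noteq> 0"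
    unfolding X_def Y_def Z_def by (simp_all add: side_vertex_nonzero)
  have indep: "w = 0" if "X w = 0" "Y w = 0" "Z w = 0" for w
    using tv[of w] that t by (simp add: t_def)
  have not_prop: False if "i \<noteq> j" "z *s A j - z' *s A i = 0" "z \<noteq> 0" for i j z z'
  proof -
    have "z *s cross_prod (A i) (A j) = cross_prod (A i) (z *s A j - z' *s A i)"
      by (simp add: vec3_simps algebra_simps)
    then show False using that vertices_distinct[OF that(1)] by (simp add: vec3_simps)
  qed
  have "Y (A 1) * Z (A 2) \<noteq> Y (A 2) * Z (A 1)"
  proof
    assume "Y (A 1) * Z (A 2) = Y (A 2) * Z (A 1)"
    then have "Z (A 1) *s A 2 - Z (A 2) *s A 1 = 0"
      using zero by (intro indep) (auto simp: X_def Y_def Z_def mult.commute)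
    from not_prop[OF _ this] Z show False by simp
  qed
  then have e1: "q3 * Y (A 1) * Y (A 2) = q5 * Z (A 1) * Z (A 2)"
    using QA[of 1] QA[of 2] zero by (intro carnot_edge[where s = q35]) auto
  have "Z (A 3) * X (A 4) \<noteq> Z (A 4) * X (A 3)"
  proof
    assume "Z (A 3) * X (A 4) = Z (A 4) * X (A 3)"
    then have "Z (A 3) *s A 4 - Z (A 4) *s A 3 = 0"
      using zero by (intro indep) (auto simp: X_def Y_def Z_def mult.commute)
    from not_prop[OF _ this] Z show False by simp
  qed
  then have e3: "q5 * Z (A 3) * Z (A 4) = q1 * X (A 3) * X (A 4)"
    using QA[of 3] QA[of 4] zero by (intro carnot_edge[where s = q15]) (auto simp: algebra_simps)
  have "X (A 5) * Y (A 0) \<noteq> X (A 0) * Y (A 5)"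
  proof
    assume "X (A 5) * Y (A 0) = X (A 0) * Y (A 5)"
    then have "X (A 5) *s A 0 - X (A 0) *s A 5 = 0"
      using zero by (intro indep) (auto simp: X_def Y_def Z_def mult.commute)
    from not_prop[OF _ this] X show False by simp
  qed
  then have e5: "q1 * X (A 5) * X (A 0) = q3 * Y (A 5) * Y (A 0)"
    using QA[of 5] QA[of 0] zero by (intro carnot_edge[where s = q13]) auto
  \<comment> \<open>If one diagonal coefficient vanishes, then all do, and a vertex on each edge kills the mixed ones.\<close>
  have q: "q1 \<noteq> 0 \<and> q3 \<noteq> 0 \<and> q5 \<noteq> 0"
  proof (rule ccontr)
    assume "\<not> ?thesis"
    then have d: "q1 = 0" "q3 = 0" "q5 = 0" using e1 e3 e5 X Y Z by auto
    moreover have "q35 = 0" "q15 = 0" "q13 = 0"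
      using QA[of 1] QA[of 3] QA[of 5] d zero X Y Z by auto
    ultimately show False using Qt[of v] nonzero t by (simp add: t_def)
  qed
  have carnot: "Y (A 1) * Y (A 2) * X (A 0) * X (A 5) * Z (A 3) * Z (A 4)
      = Z (A 1) * Z (A 2) * Y (A 0) * Y (A 5) * X (A 3) * X (A 4)"
  proof -
    have "(q1 * q3 * q5) * (Y (A 1) * Y (A 2) * X (A 0) * X (A 5) * Z (A 3) * Z (A 4))
      = (q1 * q3 * q5) * (Z (A 1) * Z (A 2) * Y (A 0) * Y (A 5) * X (A 3) * X (A 4))"
      using arg_cong2[OF arg_cong2[OF e1 e3, of "(*)"] e5, of "(*)"] by (simp only: mult_ac)
    then show ?thesis using q by simp
  qed
  \<comment> \<open>The coefficients of a side in terms of the odd sides.\<close>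
  define c1 c3 c5 where "c1 j = det3 (L j) (L 3) (L 5) / t" and "c3 j = det3 (L 1) (L j) (L 5) / t"
    and "c5 j = det3 (L 1) (L 3) (L j) / t" for j
  have L: "L j = c1 j *s L 1 + c3 j *s L 3 + c5 j *s L 5" for j
  proof -
    have "L j = (1 / t) *s (t *s L j)" using t by (simp add: t_def)
    also have "t *s L j = det3 (L j) (L 3) (L 5) *s L 1 + det3 (L 1) (L j) (L 5) *s L 3
        + det3 (L 1) (L 3) (L j) *s L 5"
      unfolding t_def by (rule cramer)
    also have "(1 / t) *s \<dots> = c1 j *s L 1 + c3 j *s L 3 + c5 j *s L 5"
      unfolding c1_def c3_def c5_def by (simp add: vec_eq_iff algebra_simps)
    finally show ?thesis .
  qed
  have c: "c1 4 \<noteq> 0" "c1 2 \<noteq> 0" "c1 0 \<noteq> 0" "c3 4 \<noteq> 0" "c3 2 \<noteq> 0" "c3 0 \<noteq> 0" "c5 4 \<noteq> 0" "c5 2 \<noteq> 0" "c5 0 \<noteq> 0"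
    using t unfolding c1_def c3_def c5_def t_def by (simp_all add: sides_det_nonzero)
  have dotL: "dot (L j) v = c1 j * X v + c3 j * Y v + c5 j * Z v" for j v
    unfolding X_def Y_def Z_def by (subst L) simp
  have "c1 4 * X (A 4) + c5 4 * Z (A 4) = 0" "c1 4 * X (A 5) + c3 4 * Y (A 5) = 0"
    "c1 0 * X (A 0) + c3 0 * Y (A 0) = 0" "c3 0 * Y (A 1) + c5 0 * Z (A 1) = 0"
    "c3 2 * Y (A 2) + c5 2 * Z (A 2) = 0" "c1 2 * X (A 3) + c5 2 * Z (A 3) = 0"
    using side_vertices(1)[of 4] side_vertices(2)[of 4] side_vertices(1)[of 0] side_vertices(2)[of 0]
      side_vertices(1)[of 2] side_vertices(2)[of 2] zero by (simp_all add: dotL)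
  then have "c1 4 * (c3 4 * Y (A 5) * X (A 4)) = c1 4 * (c5 4 * Z (A 4) * X (A 5))"
     "c3 0 * (c5 0 * Z (A 1) * Y (A 0)) = c3 0 * (c1 0 * X (A 0) * Y (A 1))"
     "c5 2 * (c3 2 * Y (A 2) * Z (A 3)) = c5 2 * (c1 2 * X (A 3) * Z (A 2))"
    by algebra+
  then have r: "c3 4 * Y (A 5) * X (A 4) = c5 4 * Z (A 4) * X (A 5)"
     "c5 0 * Z (A 1) * Y (A 0) = c1 0 * X (A 0) * Y (A 1)"
     "c3 2 * Y (A 2) * Z (A 3) = c1 2 * X (A 3) * Z (A 2)" using c by simp_all
  have compat: "c5 0 * c1 2 * c3 4 = c1 0 * c3 2 * c5 4"
  proof -
    have "(Z (A 1) * Z (A 2) * Y (A 0) * Y (A 5) * X (A 3) * X (A 4)) * (c5 0 * c1 2 * c3 4)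
      = (Y (A 1) * Y (A 2) * X (A 0) * X (A 5) * Z (A 3) * Z (A 4)) * (c1 0 * c3 2 * c5 4)"
      using arg_cong2[OF arg_cong2[OF r(1,2), of "(*)"] r(3)[symmetric], of "(*)"] by (simp only: mult_ac)
    then have "(Z (A 1) * Z (A 2) * Y (A 0) * Y (A 5) * X (A 3) * X (A 4)) * (c5 0 * c1 2 * c3 4)
      = (Z (A 1) * Z (A 2) * Y (A 0) * Y (A 5) * X (A 3) * X (A 4)) * (c1 0 * c3 2 * c5 4)"
      unfolding carnot .
    then show ?thesis using X Y Z by simp
  qed
  define \<beta> \<gamma> where "\<beta> = c3 2 / c1 2" and "\<gamma> = c5 0 / c1 0"
  define E where "E = L 1 + \<beta> *s L 3 + \<gamma> *s L 5"
  define s4 s0 s2 where "s4 = \<beta> / c3 4" and "s0 = 1 / c1 0" and "s2 = 1 / c1 2"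
  define s1 s3 s5 where "s1 = 1 - s4 * c1 4" and "s3 = \<beta> - s0 * c3 0" and "s5 = \<gamma> - s2 * c5 2"
  have even: "s4 \<noteq> 0" "s0 \<noteq> 0" "s2 \<noteq> 0" using c by (simp_all add: s4_def s0_def s2_def \<beta>_def)
  have "s4 * c3 4 = \<beta>" "s4 * c5 4 = \<gamma>"
    using c compat by (simp_all add: s4_def \<beta>_def \<gamma>_def field_simps)
  then have E1: "s1 *s L 1 + s4 *s L 4 = E"
    unfolding E_def s1_def L[of 4] by (simp add: vec_eq_iff algebra_simps)
  have E3: "s3 *s L 3 + s0 *s L 0 = E"
    using c unfolding E_def s3_def L[of 0] s0_def \<gamma>_def by (simp add: vec_eq_iff field_simps)
  have E5: "s5 *s L 5 + s2 *s L 2 = E"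
    using c unfolding E_def s5_def L[of 2] s2_def \<beta>_def by (simp add: vec_eq_iff field_simps)
  \<comment> \<open>A vanishing scalar would put the even side into the pencil of two other opposite sides.\<close>
  have odd: "a \<noteq> 0" if *: "a *s L i + b *s L j = E" "b \<noteq> 0" "e *s L m + f *s L n = E" "distinct [m, n, j]"
    for a b e f i j m n
  proof
    assume "a = 0"
    then have "b *s L j = e *s L m + f *s L n" using * by simp
    then have "dot (b *s L j) (cross_prod (L m) (L n)) = dot (e *s L m + f *s L n) (cross_prod (L m) (L n))"
      by (rule arg_cong)
    then have "b * dot (L j) (cross_prod (L m) (L n)) = 0" by simp
    then have "det3 (L m) (L n) (L j) = 0" using * by (simp add: det3_def dot_commute)
    then show False using sides_det_nonzero * by blast
  qed
  have odds: "s1 \<noteq> 0" "s3 \<noteq> 0" "s5 \<noteq> 0"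
    using odd[OF E1 even(1) E3] odd[OF E3 even(2) E1] odd[OF E5 even(3) E1] by simp_all
  define s where "s j = (if j = 1 then s1 else if j = 2 then s2 else if j = 3 then s3
    else if j = 4 then s4 else if j = 5 then s5 else s0)" for j :: 6
  have "\<forall>j. s j \<noteq> 0" unfolding forall_6 using even odds by (simp add: s_def)
  moreover have "\<forall>j. s j *s L j + s (j + 3) *s L (j + 3) = E"
    unfolding forall_6 using E1 E3 E5 by (simp add: s_def num_6 add.commute)
  ultimately show thesis using that by blast
qed

end

section \<open>The Jacobian ideal in the degree of its generators\<close>

lemma isCont_eval_line: "isCont (\<lambda>t. eval p (N + t *s w)) t0"
  unfolding eval_def vector_add_component vector_smult_component by (intro continuous_intros)

lemma eval_scale:
  assumes "p \<in> forms k"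
  shows "eval p (t *s v) = t ^ k * eval p v"
proof -
  have m: "(\<Prod>i\<in>UNIV. (t *s v) $ i ^ Poly_Mapping.lookup m i) = t ^ k * (\<Prod>i\<in>UNIV. v $ i ^ Poly_Mapping.lookup m i)"
    if "m \<in> Poly_Mapping.keys p" for m
  proof -
    have "k = (\<Sum>i\<in>UNIV. Poly_Mapping.lookup m i)"
      using assms that by (simp add: forms_def monom_degree_def)
    then show ?thesis
      by (simp only: power_sum vector_smult_component power_mult_distrib prod.distrib)
  qed
  show ?thesis
    unfolding eval_def sum_distrib_left by (intro sum.cong refl) (simp only: m mult.left_commute)
qed

lemma partial_deriv_forms:
  assumes "p \<in> forms (Suc k)"
  shows "partial_deriv i p \<in> forms k"
  unfolding partial_deriv_def
proof (rule forms_sum)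
  fix m assume "m \<in> Poly_Mapping.keys p"
  then have m: "monom_degree m = Suc k" using assms by (simp add: forms_def)
  show "Poly_Mapping.single (m - Poly_Mapping.single i 1)
      (of_nat (Poly_Mapping.lookup m i) * Poly_Mapping.lookup p m) \<in> forms k"
  proof (cases "Poly_Mapping.lookup m i = 0")
    case False
    then have "m = Poly_Mapping.single i 1 + (m - Poly_Mapping.single i 1)"
      by (intro poly_mapping_eqI) (auto simp: lookup_minus lookup_add lookup_single when_def)
    then have "monom_degree (m - Poly_Mapping.single i 1) = k"
      using m monom_degree_add monom_degree_single by (metis add_left_cancel plus_1_eq_Suc)
    then show ?thesis by (auto simp: forms_def)
  qed (simp add: forms_0)
qed

text \<open>The partial derivatives have degree \<open>k\<close>, so the elements of degree \<open>k\<close> are their combinations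
  with constant coefficients, that is, directional derivatives. The constants are the values of
  the coefficients at the origin: rescale the point by \<open>t\<close>, cancel \<open>t ^ k\<close> and let \<open>t\<close> tend to 0.\<close>

lemma jacobian_lowest_degree:
  assumes h: "h \<in> jacobian_ideal f" "h \<in> forms k" and f: "f \<in> forms (Suc k)"
  obtains u where "\<And>v. eval h v = eval (dir_deriv u f) v"
proof -
  obtain r1 r2 r3 where r: "h = r1 * partial_deriv 1 f + r2 * partial_deriv 2 f + r3 * partial_deriv 3 f"
    using h(1) unfolding jacobian_ideal_def by (rule ideal_gen_3)
  define G where "G v t = eval r1 (0 + t *s v) * eval (partial_deriv 1 f) v
      + eval r2 (0 + t *s v) * eval (partial_deriv 2 f) v + eval r3 (0 + t *s v) * eval (partial_deriv 3 f) v" for v t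
  have "eval h v = G v 0" for v
  proof -
    have "G v t = eval h v" if "t \<noteq> 0" for t
    proof -
      have "t ^ k * eval h v = eval h (t *s v)" by (rule eval_scale[OF h(2), symmetric])
      also have "\<dots> = t ^ k * G v t"
        unfolding r G_def by (simp add: eval_scale[OF partial_deriv_forms[OF f]] algebra_simps)
      finally have "t ^ k * G v t = t ^ k * eval h v" ..
      then show ?thesis using that by simp
    qed
    then have ev: "\<forall>\<^sub>F t in at 0. G v t = eval h v"
      by (auto simp: eventually_at_filter)
    have "isCont (G v) 0"
      unfolding G_def by (intro continuous_intros isCont_eval_line)
    then have "(G v \<longlongrightarrow> G v 0) (at 0)" by (simp add: isCont_def)
    from Lim_transform_eventually[OF this ev] show ?thesis by (rule tendsto_unique[OF trivial_limit_at tendsto_const])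
  qed
  then show thesis
    by (intro that[of "vector [eval r1 0, eval r2 0, eval r3 0]"]) (simp add: G_def dir_deriv_def sum_3)
qed

lemma prod_lin_form_forms: "finite I \<Longrightarrow> (\<Prod>i\<in>I. lin_form (g i)) \<in> forms (card I)"
proof (induction I rule: finite_induct)
  case empty
  show ?case using const_poly_forms[of 1] by simp
next
  case (insert i I)
  then show ?case using forms_mult[OF lin_form_forms, of "\<Prod>i\<in>I. lin_form (g i)" "card I" "g i"] by simp
qed

lemma ex_off_lines:
  assumes "finite F" "\<And>i. i \<in> F \<Longrightarrow> z i \<noteq> 0"
  obtains w where "\<And>i. i \<in> F \<Longrightarrow> dot (z i) w \<noteq> 0"
proof -
  \<comment> \<open>A line meets the conic with points \<open>(1, t, t * t)\<close> in finitely many points.\<close>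
  let ?p = "\<lambda>i. [:z i $ 1, z i $ 2, z i $ 3:]"
  have "finite {t. poly (?p i) t = 0}" if "i \<in> F" for i
    using assms(2)[OF that] by (intro poly_roots_finite) (auto simp: vec_eq_iff forall_3)
  then have "finite (\<Union>i\<in>F. {t. poly (?p i) t = 0})" using assms(1) by blast
  then obtain t where t: "t \<notin> (\<Union>i\<in>F. {t. poly (?p i) t = 0})"
    using ex_new_if_finite infinite_UNIV_char_0 by blast
  have "dot (z i) (vector [1, t, t\<^sup>2]) \<noteq> 0" if "i \<in> F" for i
    using t that by (auto simp: dot_def sum_3 power2_eq_square algebra_simps)
  then show thesis by (rule that)
qed

section \<open>The quartic form\<close>

definition opposite_sides :: "(6 \<Rightarrow> complex ^ 3) \<Rightarrow> 6 \<Rightarrow> poly3" where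
  "opposite_sides n j = lin_form (n j) * lin_form (n (j + 3))"

text \<open>With the scaled side equations \<open>n\<close> this is the elementary symmetric polynomial of degree 2 in
  the three products of opposite sides.\<close>

definition hex_quartic :: "(6 \<Rightarrow> complex ^ 3) \<Rightarrow> poly3" where
  "hex_quartic n = opposite_sides n 1 * opposite_sides n 2 + opposite_sides n 2 * opposite_sides n 3 + opposite_sides n 3 * opposite_sides n 1"

lemma opposite_forms: "opposite_sides n j \<in> forms 2"
  using forms_mult[OF lin_form_forms lin_form_forms] unfolding opposite_sides_def numeral_2_eq_2 by simp

lemma hex_quartic_forms: "hex_quartic n \<in> forms 4"
  using forms_mult[OF opposite_forms opposite_forms] unfolding hex_quartic_def
  by (intro forms_add) simp_all

lemma opposite_shift: "opposite_sides n (j + 3) = opposite_sides n j"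
proof -
  have "j + 3 + 3 = j" by (simp add: num_6)
  then show ?thesis unfolding opposite_sides_def by (simp only: mult.commute)
qed

text \<open>The hexagon may be rotated, so computations at one vertex serve for all six.\<close>

lemma hex_quartic_cyclic: "hex_quartic n = opposite_sides n j * opposite_sides n (j + 1)
    + opposite_sides n (j + 1) * opposite_sides n (j + 2) + opposite_sides n (j + 2) * opposite_sides n j"
proof -
  have s: "opposite_sides n 4 = opposite_sides n 1" "opposite_sides n 5 = opposite_sides n 2" "opposite_sides n 0 = opposite_sides n 3"
    using opposite_shift[of n 1] opposite_shift[of n 2] opposite_shift[of n 3] by (simp_all add: num_6)
  have "\<forall>j. hex_quartic n = opposite_sides n j * opposite_sides n (j + 1)
    + opposite_sides n (j + 1) * opposite_sides n (j + 2) + opposite_sides n (j + 2) * opposite_sides n j"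
    unfolding forall_6 hex_quartic_def by (simp add: num_6 s algebra_simps)
  then show ?thesis ..
qed

context hexagon_lines
begin

abbreviation "line \<equiv> case_sum L D"

lemma vertex_if_adjacent:
  assumes "P \<noteq> 0" "dot (L (j - 1)) P = 0" "dot (L j) P = 0"
  obtains c where "c \<noteq> 0" "P = c *s A j"
proof -
  have C: "cross_prod (L (j - 1)) (L j) \<noteq> 0" by (rule sides_independent) simp
  obtain a where a: "P = a *s cross_prod (L (j - 1)) (L j)" using common_zero[OF C] assms by metis
  obtain b where b: "A j = b *s cross_prod (L (j - 1)) (L j)"
    using common_zero[OF C] side_prev_vertex side_vertices(1) by metis
  have "a \<noteq> 0" "b \<noteq> 0" using a b assms(1) vertex_nonzero[of j] by auto
  then have "P = (a / b) *s A j" using a b by simp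
  then show thesis using that[of "a / b"] \<open>a \<noteq> 0\<close> \<open>b \<noteq> 0\<close> by simp
qed

lemma diag_nonzero: "D (diag_index j) \<noteq> 0"
  using lines_distinct[of "Inr (diag_index j)" "Inl 1"] diag_in_index[of j]
  by (auto simp: line_index_def cross_prod_def vec3_simps)

context
  fixes s :: "6 \<Rightarrow> complex" and E :: "complex ^ 3" and n :: "6 \<Rightarrow> complex ^ 3"
  assumes s: "\<And>j. s j \<noteq> 0" and n: "\<And>j. n j = s j *s L j" and E: "\<And>j. n j + n (j + 3) = E"
begin

text \<open>Pascal's normalization also fixes the diagonals: \<open>n j - n (j - 1)\<close> vanishes at \<open>A j\<close>, and since
  opposite sides add up to \<open>E\<close> it equals \<open>n (j + 2) - n (j + 3)\<close>, which vanishes at \<open>A (j + 3)\<close>.\<close>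

lemma diagonal_eq:
  obtains \<delta> where "\<delta> \<noteq> 0" "D (diag_index j) = \<delta> *s (n j - n (j - 1))"
proof -
  define w where "w = n j - n (j - 1)"
  let ?C = "cross_prod (A j) (A (j + 3))"
  have C: "?C \<noteq> 0" by (rule vertices_distinct) simp
  have w': "w = n (j + 2) - n (j + 3)"
  proof -
    have "n j = E - n (j + 3)" "n (j - 1) = E - n (j - 1 + 3)"
      unfolding eq_diff_eq by (rule E)+
    moreover have "j - 1 + 3 = j + 2" by simp
    ultimately show ?thesis unfolding w_def by simp
  qed
  have "dot (A j) w = 0"
    using side_vertices(1)[of j] side_prev_vertex[of j] by (simp add: w_def n dot_commute[of "A j"])
  moreover have "dot (A (j + 3)) w = 0"
    using side_vertices(1)[of "j + 3"] side_prev_vertex[of "j + 3"]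
    by (simp add: w' n dot_commute[of "A (j + 3)"] add.commute[of 2 j])
  ultimately obtain a where a: "w = a *s ?C" using common_zero[OF C] by blast
  have "dot (A j) (D (diag_index j)) = 0" "dot (A (j + 3)) (D (diag_index j)) = 0"
    using diag_vertex[of j] by (simp_all only: dot_commute)
  then obtain b where b: "D (diag_index j) = b *s ?C" using common_zero[OF C] by blast
  have "b \<noteq> 0" using b diag_nonzero[of j] by auto
  have "w \<noteq> 0"
  proof
    assume "w = 0"
    then have "s j *s L j = s (j - 1) *s L (j - 1)" by (simp add: w_def n)
    then have "s j *s cross_prod (L j) (L (j - 1)) = cross_prod (s (j - 1) *s L (j - 1)) (L (j - 1))"
      by (simp flip: cross_prod_scale)
    then have "s j *s cross_prod (L j) (L (j - 1)) = 0" by (simp add: cross_prod_scale)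
    then show False using s sides_independent[of j "j - 1"] by simp
  qed
  then have "a \<noteq> 0" using a by auto
  have "D (diag_index j) = (b / a) *s w" using a b \<open>a \<noteq> 0\<close> by simp
  then show thesis using that[of "b / a"] \<open>a \<noteq> 0\<close> \<open>b \<noteq> 0\<close> w_def by simp
qed

text \<open>Replacing the opposite sides \<open>n (j + 3)\<close> and \<open>n (j - 1 + 3)\<close> by \<open>E - n j\<close> and
  \<open>E - n (j - 1)\<close> shows the linear part \<open>n j + n (j - 1)\<close> of the quartic at \<open>A j\<close>, harmonically
  conjugate to the diagonal \<open>n j - n (j - 1)\<close>, in the shape used in
  \<open>jacobian_at_triple_point\<close>.\<close>

lemma quartic_at_vertex: "hex_quartic n = lin_form (n j) * lin_form (n (j - 1)) * ((lin_form E - lin_form (n j)) * (lin_form E - lin_form (n (j - 1))))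
    + opposite_sides n (j + 1) * (lin_form E * (lin_form (n j) + lin_form (n (j - 1))) - (lin_form (n j))\<^sup>2 - (lin_form (n (j - 1)))\<^sup>2)"
proof -
  have "n (j + 3) = E - n j" using E[of j] by (metis add_diff_cancel_left')
  then have 1: "opposite_sides n j = lin_form (n j) * (lin_form E - lin_form (n j))"
    unfolding opposite_sides_def by (simp add: lin_form_diff)
  have "n (j - 1 + 3) = E - n (j - 1)" using E[of "j - 1"] by (metis add_diff_cancel_left')
  then have "opposite_sides n (j - 1) = lin_form (n (j - 1)) * (lin_form E - lin_form (n (j - 1)))"
    unfolding opposite_sides_def by (simp add: lin_form_diff)
  moreover have "opposite_sides n (j + 2) = opposite_sides n (j - 1)"
    using opposite_shift[of n "j - 1"] by (simp add: add.commute[of 2 j])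
  ultimately have 2: "opposite_sides n (j + 2) = lin_form (n (j - 1)) * (lin_form E - lin_form (n (j - 1)))" by simp
  show ?thesis
    unfolding hex_quartic_cyclic[of n j] 1 2 by algebra
qed

lemma quartic_vertex: "eval (hex_quartic n) (A j) = 0"
  unfolding quartic_at_vertex[of j] using side_vertices(1)[of j] side_prev_vertex[of j]
  by (simp add: n)

lemma quartic_at_alternate: "hex_quartic n
    = lin_form (n j) * (lin_form (n (j + 3)) * (opposite_sides n (j + 1) + opposite_sides n (j + 2)))
    + lin_form (n (j + 2)) * (opposite_sides n (j + 1) * lin_form (n (j + 5)))"
  unfolding hex_quartic_cyclic[of n j] by (simp add: opposite_sides_def algebra_simps)

lemma quartic_alternate:
  assumes "dot (L j) v = 0" "dot (L (j + 2)) v = 0"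
  shows "eval (hex_quartic n) v = 0"
  unfolding quartic_at_alternate[of j] using assms by (simp add: n)

lemma opposite_not_vertex:
  assumes "P \<noteq> 0" "dot (L j) P = 0" "dot (L (j + 3)) P = 0" "k \<in> {1, 2, 3}"
  shows "dot (D k) P \<noteq> 0"
proof
  let ?T = "{Inl j, Inl (j + 3), Inr k} :: (6 + 6) set"
  assume D: "dot (D k) P = 0"
  have "?T \<subseteq> line_index" using assms(4) unfolding line_index_def by blast
  moreover have "card ?T = 3" by simp
  moreover have "dot (line a) P = 0" if "a \<in> ?T" for a using that assms D by auto
  ultimately obtain m where m: "?T = {Inl m, Inl (m - 1), Inr (diag_index m)}"
    using three_lines_vertex[OF assms(1)] by blast
  then have "(Inl j :: 6 + 6) \<in> {Inl m, Inl (m - 1), Inr (diag_index m)}"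
    "(Inl (j + 3) :: 6 + 6) \<in> {Inl m, Inl (m - 1), Inr (diag_index m)}" by blast+
  then have "(j = m \<or> j = m - 1) \<and> (j + 3 = m \<or> j + 3 = m - 1)" by simp
  moreover have "\<forall>m. \<not> ((j = m \<or> j = m - 1) \<and> (j + 3 = m \<or> j + 3 = m - 1))"
  proof -
    have "\<forall>j. \<forall>m. \<not> ((j = m \<or> j = m - 1) \<and> (j + 3 = m \<or> j + 3 = m - (1::6)))"
      unfolding forall_6 by simp
    then show ?thesis by blast
  qed
  ultimately show False by blast
qed

text \<open>Of the three products of opposite sides only \<open>opposite_sides n 1\<close> vanishes at the point where
  the sides 1 and 4 meet.\<close>

lemma quartic_opposite:
  assumes "P \<noteq> 0" "dot (L 1) P = 0" "dot (L 4) P = 0"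
  shows "eval (hex_quartic n) P \<noteq> 0"
proof -
  have "dot (L j) P \<noteq> 0" if "j \<noteq> 1" "j \<noteq> 4" for j
    using sides_not_concurrent[OF assms(1), of 1 4 j] assms that by simp
  then show ?thesis
    using assms s by (simp add: hex_quartic_def opposite_sides_def n num_6)
qed

end

end

section \<open>The octic form\<close>

context hexagon_lines
begin

definition hex_octic :: "complex ^ 3 \<Rightarrow> (6 \<Rightarrow> complex ^ 3) \<Rightarrow> poly3" where
  "hex_octic p n = lin_form p * lin_form (D 1) * lin_form (D 2) * lin_form (D 3) * hex_quartic n"

definition hex_product :: poly3 where
  "hex_product = (\<Prod>a\<in>line_index. lin_form (line a))"

lemma octic_forms: "hex_octic p n \<in> forms 8"
proof -
  have "hex_octic p n \<in> forms (1 + 1 + 1 + 1 + 4)"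
    unfolding hex_octic_def by (intro forms_mult lin_form_forms hex_quartic_forms)
  then show ?thesis by simp
qed

lemma octic_diagonal_factor:
  assumes "k \<in> {1, 2, 3}"
  obtains r where "hex_octic p n = r * lin_form (D k) * hex_quartic n"
proof -
  have "hex_octic p n = (lin_form p * lin_form (D 2) * lin_form (D 3)) * lin_form (D 1) * hex_quartic n"
    "hex_octic p n = (lin_form p * lin_form (D 1) * lin_form (D 3)) * lin_form (D 2) * hex_quartic n"
    "hex_octic p n = (lin_form p * lin_form (D 1) * lin_form (D 2)) * lin_form (D 3) * hex_quartic n"
    by (simp_all add: hex_octic_def mult_ac)
  then show thesis using assms that by blast
qed

context
  fixes s :: "6 \<Rightarrow> complex" and E :: "complex ^ 3" and n :: "6 \<Rightarrow> complex ^ 3" and p :: "complex ^ 3"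
  assumes s: "\<And>j. s j \<noteq> 0" and n: "\<And>j. n j = s j *s L j" and E: "\<And>j. n j + n (j + 3) = E"
    and p: "\<And>j v. v \<noteq> 0 \<Longrightarrow> dot (L j) v = 0 \<Longrightarrow> dot (L (j + 3)) v = 0 \<Longrightarrow> dot p v = 0"
begin

text \<open>At a double point some factor of the octic form lies in the ideal of the two lines: a diagonal if it
  passes through the point, the quartic if two alternate sides meet there, and the Pascal
  line if two opposite sides do.\<close>

lemma octic_at_double_point:
  assumes "N \<noteq> 0" and no_vertex: "\<And>j c. c \<noteq> 0 \<Longrightarrow> N \<noteq> c *s A j"
    and ab: "a \<in> line_index" "b \<in> line_index" "a \<noteq> b" "dot (line a) N = 0" "dot (line b) N = 0"
  shows "\<exists>r t. hex_octic p n = r * lin_form (line a) + t * lin_form (line b)"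
proof -
  have diagonal: "\<exists>r. hex_octic p n = r * lin_form (D k)" if k: "k \<in> {1, 2, 3}" for k
  proof -
    obtain r where "hex_octic p n = r * lin_form (D k) * hex_quartic n" using octic_diagonal_factor[OF k] .
    then have "hex_octic p n = (r * hex_quartic n) * lin_form (D k)" by (simp add: mult_ac)
    then show ?thesis ..
  qed
  have sides: "\<exists>r t. hex_octic p n = r * lin_form (L i) + t * lin_form (L j)"
    if ij: "j = i + 1 \<or> j = i + 2 \<or> j = i + 3" "dot (L i) N = 0" "dot (L j) N = 0" for i j
    using ij(1)
  proof (elim disjE)
    assume j: "j = i + 1"
    have "False"
      using vertex_if_adjacent[of N j] ij j assms(1) no_vertex by auto
    then show ?thesis ..
  next
    assume j: "j = i + 2"
    have "lin_form (n i) = const_poly (s i) * lin_form (L i)" "lin_form (n (i + 2)) = const_poly (s j) * lin_form (L j)"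
      by (simp_all add: n lin_form_scale j)
    then have "hex_octic p n = (lin_form p * lin_form (D 1) * lin_form (D 2) * lin_form (D 3) * const_poly (s i) * (lin_form (n (i + 3)) * (opposite_sides n (i + 1) + opposite_sides n (i + 2)))) * lin_form (L i)
      + (lin_form p * lin_form (D 1) * lin_form (D 2) * lin_form (D 3) * const_poly (s j) * (opposite_sides n (i + 1) * lin_form (n (i + 5)))) * lin_form (L j)"
      unfolding hex_octic_def quartic_at_alternate[OF s n E, of i] by (simp add: algebra_simps)
    then show ?thesis by blast
  next
    assume j: "j = i + 3"
    have "cross_prod (L i) (L j) \<noteq> 0" using j by (intro sides_independent) simp
    moreover from this have "dot p (cross_prod (L i) (L j)) = 0"
      using p[of "cross_prod (L i) (L j)" i] j by simp
    ultimately obtain r t where "p = r *s L i + t *s L j" by (rule in_pencil)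
    then have "hex_octic p n = (const_poly r * lin_form (D 1) * lin_form (D 2) * lin_form (D 3) * hex_quartic n) * lin_form (L i)
      + (const_poly t * lin_form (D 1) * lin_form (D 2) * lin_form (D 3) * hex_quartic n) * lin_form (L j)"
      by (simp add: hex_octic_def lin_form_add lin_form_scale algebra_simps)
    then show ?thesis by blast
  qed
  show ?thesis
  proof (cases a)
    case (Inr k)
    then obtain r where "hex_octic p n = r * lin_form (line a)" using diagonal[of k] ab by (auto simp: line_index_def)
    then have "hex_octic p n = r * lin_form (line a) + 0 * lin_form (line b)" by simp
    then show ?thesis by blast
  next
    case a: (Inl i)
    show ?thesis
    proof (cases b)
      case (Inr k)
      then obtain r where "hex_octic p n = r * lin_form (line b)" using diagonal[of k] ab by (auto simp: line_index_def)
      then have "hex_octic p n = 0 * lin_form (line a) + r * lin_form (line b)" by simp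
      then show ?thesis by blast
    next
      case b: (Inl j)
      have "i \<noteq> j" using a b ab by simp
      from pairs_of_sides[OF this] consider "j = i + 1 \<or> j = i + 2 \<or> j = i + 3" | "i = j + 1 \<or> i = j + 2 \<or> i = j + 3"
        by blast
      then show ?thesis
      proof cases
        case 1
        then show ?thesis using sides[of j i] ab a b by simp
      next
        case 2
        then obtain r t where "hex_octic p n = r * lin_form (L j) + t * lin_form (L i)" using sides[of i j] ab a b by auto
        then have "hex_octic p n = t * lin_form (line a) + r * lin_form (line b)" using a b by (simp add: add.commute)
        then show ?thesis by blast
      qed
    qed
  qed
qed

lemma octic_in_saturation: "hex_octic p n \<in> sat_jacobian_ideal hex_product"
  unfolding sat_jacobian_ideal_def jacobian_ideal_def
proof (rule saturation_if_local[where I = line_index and g = line])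
  fix N :: "complex ^ 3"
  assume N: "N \<noteq> 0" and two: "2 \<le> card {a \<in> line_index. dot (line a) N = 0}"
  define T where "T = {a \<in> line_index. dot (line a) N = 0}"
  define V where "V = {a \<in> line_index. dot (line a) N \<noteq> 0}"
  define g where "g = (\<Prod>a\<in>V. lin_form (line a))"
  have TV: "T \<inter> V = {}" "line_index = T \<union> V" "finite T" "finite V"
    using finite_line_index by (auto simp: T_def V_def)
  have f: "hex_product = (\<Prod>a\<in>T. lin_form (line a)) * g"
    unfolding hex_product_def g_def TV(2) using TV by (intro prod.union_disjoint) auto
  have fJ: "hex_product \<in> jacobian_ideal hex_product"
    unfolding hex_product_def
    using card_line_index by (intro prod_lin_form_in_jacobian finite_line_index) auto
  have "g\<^sup>2 * hex_octic p n \<in> jacobian_ideal hex_product"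
  proof (cases "\<exists>j c. c \<noteq> 0 \<and> N = c *s A j")
    case True
    then obtain j where "T = {Inl j, Inl (j - 1), Inr (diag_index j)}"
      using lines_at_vertex unfolding T_def by blast
    then have prod_T: "(\<Prod>a\<in>T. lin_form (line a)) = lin_form (L j) * lin_form (L (j - 1)) * lin_form (D (diag_index j))"
      by (simp add: mult.assoc)
    obtain \<delta> where \<delta>: "\<delta> \<noteq> 0" "D (diag_index j) = \<delta> *s (n j - n (j - 1))"
      using diagonal_eq[OF s n E] .
    have d: "lin_form (D (diag_index j)) = const_poly \<delta> * (lin_form (n j) - lin_form (n (j - 1)))"
      unfolding \<delta>(2) lin_form_scale lin_form_diff ..
    have L: "lin_form (L i) = const_poly (1 / s i) * lin_form (n i)" for i
      unfolding n using s by (rule lin_form_scaled)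
    have "hex_product = const_poly (1 / s j * (1 / s (j - 1)) * \<delta>) * lin_form (n j) * lin_form (n (j - 1))
        * (lin_form (n j) - lin_form (n (j - 1))) * g"
      unfolding f prod_T d L const_poly_mult by (simp only: mult_ac)
    moreover have "1 / s j * (1 / s (j - 1)) * \<delta> \<noteq> 0" using s \<delta> by simp
    moreover have "cross_prod (n j) (n (j - 1)) \<noteq> 0"
    proof -
      have "cross_prod (n j) (n (j - 1)) = (s j * s (j - 1)) *s cross_prod (L j) (L (j - 1))"
        unfolding n by (simp add: vec3_simps algebra_simps)
      then show ?thesis using s sides_independent[of j "j - 1"] by simp
    qed
    moreover obtain r where "hex_octic p n = r * lin_form (D (diag_index j)) * hex_quartic n"
      using octic_diagonal_factor[OF diag_in] .
    then have "hex_octic p n = (r * const_poly \<delta>) * (lin_form (n j) - lin_form (n (j - 1))) *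
      (lin_form (n j) * lin_form (n (j - 1)) * ((lin_form E - lin_form (n j)) * (lin_form E - lin_form (n (j - 1))))
      + opposite_sides n (j + 1) * (lin_form E * (lin_form (n j) + lin_form (n (j - 1))) - (lin_form (n j))\<^sup>2 - (lin_form (n (j - 1)))\<^sup>2))"
      unfolding d quartic_at_vertex[OF s n E, of j, symmetric] by (simp only: mult.assoc)
    ultimately show ?thesis using jacobian_at_triple_point fJ by blast
  next
    case False
    then have "card T \<noteq> 3" using triple_iff[OF N] unfolding T_def by blast
    then have "card T = 2" using two mult_le_3[OF N] unfolding T_def by linarith
    then obtain a b where ab: "T = {a, b}" "a \<noteq> b" by (auto simp: card_2_iff)
    then have ab': "a \<in> line_index" "b \<in> line_index" "dot (line a) N = 0" "dot (line b) N = 0"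
      unfolding T_def by blast+
    obtain r t where h: "hex_octic p n = r * lin_form (line a) + t * lin_form (line b)"
      using octic_at_double_point[OF N _ ab'(1,2) ab(2) ab'(3,4)] False by blast
    have "hex_product = lin_form (line a) * lin_form (line b) * g" using f ab by simp
    then show ?thesis
      using fJ lines_distinct[OF ab'(1,2) ab(2)] h by (rule jacobian_at_double_point)
  qed
  then show "(\<Prod>a\<in>{a \<in> line_index. dot (line a) N \<noteq> 0}. lin_form (line a))\<^sup>2 * hex_octic p n
      \<in> saturation (ideal_gen {partial_deriv 1 hex_product, partial_deriv 2 hex_product, partial_deriv 3 hex_product}) max_ideal"
    unfolding g_def V_def jacobian_ideal_def by (rule saturation_superset)
qed (auto simp: finite_line_index card_line_index lines_distinct)

text \<open>Otherwise the octic form is the derivative of the product of the lines along some \<open>u\<close>. It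
  vanishes on every diagonal, whereas at a general point of the \<open>k\<close>-th diagonal this derivative is
  \<open>dot (D k) u\<close> times the nonzero product of the other lines. So \<open>u\<close> lies on all three diagonals, which are not
  concurrent; hence \<open>u = 0\<close> and the octic form vanishes identically. But near the intersection of two opposite
  sides, off the Pascal line, none of its factors vanishes.\<close>

lemma octic_not_in_jacobian:
  assumes p0: "p \<noteq> 0"
  shows "hex_octic p n \<notin> jacobian_ideal hex_product"
proof
  assume "hex_octic p n \<in> jacobian_ideal hex_product"
  moreover have "hex_product \<in> forms (Suc 8)"
    using prod_lin_form_forms[OF finite_line_index, of line] card_line_index by (simp add: hex_product_def)
  ultimately obtain u where u: "\<And>v. eval (hex_octic p n) v = eval (dir_deriv u hex_product) v"
    using jacobian_lowest_degree octic_forms by blast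
  have Du: "dot (D k) u = 0" if k: "k \<in> {1, 2, 3}" for k
  proof -
    define F where "F = line_index - {Inr k}"
    have kI: "Inr k \<in> line_index" unfolding line_index_def using k by (intro UnI2 imageI)
    have finF: "finite F" unfolding F_def using finite_line_index by simp
    have f: "hex_product = lin_form (D k) * (\<Prod>a\<in>F. lin_form (line a))"
      unfolding hex_product_def F_def by (subst prod.remove[OF finite_line_index kI]) simp
    have "cross_prod (line a) (D k) \<noteq> 0" if "a \<in> F" for a
      using lines_distinct[of a "Inr k"] kI that by (simp add: F_def)
    then obtain w where w: "\<And>a. a \<in> F \<Longrightarrow> dot (cross_prod (line a) (D k)) w \<noteq> 0"
      using ex_off_lines[OF finF, of "\<lambda>a. cross_prod (line a) (D k)"] by blast
    \<comment> \<open>Cross products with \<open>D k\<close> are points of the diagonal; a general \<open>w\<close> avoids the other lines.\<close>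
    define v where "v = cross_prod (D k) w"
    have v: "dot (D k) v = 0" unfolding v_def by simp
    have "dot a v = dot (cross_prod a (D k)) w" for a
      unfolding v_def by (simp add: vec3_simps algebra_simps)
    then have nz: "eval (\<Prod>a\<in>F. lin_form (line a)) v \<noteq> 0" using w finF by simp
    obtain r where "hex_octic p n = r * lin_form (D k) * hex_quartic n" using octic_diagonal_factor[OF k] .
    then have "eval (dir_deriv u hex_product) v = 0" using u[of v] v by simp
    then show ?thesis using nz v unfolding f dir_deriv_mult by (simp del: eval_prod)
  qed
  have "u = 0"
  proof (rule ccontr)
    assume u0: "u \<noteq> 0"
    have "{Inr 1, Inr 2, Inr 3} \<subseteq> line_index" by (auto simp: line_index_def)
    moreover have "card {Inr 1, Inr 2, Inr 3 :: 6 + 6} = 3" by simp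
    moreover have "dot (line a) u = 0" if "a \<in> {Inr 1, Inr 2, Inr 3}" for a
      using that Du by auto
    ultimately obtain m where "{Inr 1, Inr 2, Inr 3 :: 6 + 6} = {Inl m, Inl (m - 1), Inr (diag_index m)}"
      using three_lines_vertex[OF u0] by blast
    then show False by blast
  qed
  then have zero: "eval (hex_octic p n) v = 0" for v
    using u[of v] by (simp add: dir_deriv_def)
  \<comment> \<open>Move from a point \<open>N\<close> of the Pascal line into a transversal direction \<open>w\<close>.\<close>
  define N where "N = cross_prod (L 1) (L 4)"
  have N: "N \<noteq> 0" "dot (L 1) N = 0" "dot (L 4) N = 0"
    using sides_independent[of 1 4] by (simp_all add: N_def)
  have pN: "dot p N = 0" using p[of N 1] N by simp
  obtain w where w: "dot p w = 1" using p0 ex_dot_1 by blast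
  define r where "r = lin_form (D 1) * lin_form (D 2) * lin_form (D 3) * hex_quartic n"
  have "eval r (N + t *s w) = 0" if "t \<noteq> 0" for t
    using zero[of "N + t *s w"] pN w that unfolding hex_octic_def r_def by auto
  then have ev: "\<forall>\<^sub>F t in at 0. eval r (N + t *s w) = 0"
    by (auto simp: eventually_at_filter)
  have "((\<lambda>t. eval r (N + t *s w)) \<longlongrightarrow> eval r (N + 0 *s w)) (at 0)"
    using isCont_eval_line[where p = r and N = N and w = w and ?t0.0 = 0] by (simp only: isCont_def)
  from Lim_transform_eventually[OF this ev] have "0 = eval r (N + 0 *s w)"
    by (rule tendsto_unique[OF trivial_limit_at tendsto_const])
  then have "eval r N = 0" by simp
  moreover have "dot (D k) N \<noteq> 0" if "k \<in> {1, 2, 3}" for k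
    using opposite_not_vertex[OF s n E N(1), of 1 k] N that by simp
  moreover have "eval (hex_quartic n) N \<noteq> 0" by (rule quartic_opposite[OF s n E N])
  ultimately show False unfolding r_def by simp
qed

end

end

section \<open>The theorem\<close>

theorem theorem1p6:
  fixes A :: "6 \<Rightarrow> complex ^ 3"
    and l d :: "6 \<Rightarrow> poly3"
  assumes hex: "hexagon A l d"
    and conic: "\<exists>Q. (smooth_conic Q \<or> two_lines_conic Q) \<and> (\<forall>j. A j \<in> zero_locus Q)"
    and nine_lines: "card (hex_lines l d) = 9"
    and only_double_or_triple:
      "\<forall>P. P \<noteq> 0 \<and> multiplicity_at (hex_lines l d) P \<ge> 2 \<longrightarrow>
         double_point (hex_lines l d) P \<or> triple_point (hex_lines l d) P"
    and triple_points:
      "\<forall>P. triple_point (hex_lines l d) P \<longleftrightarrow> (\<exists>j. same_point P (A j))"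
  shows "(\<exists>p. pascal_line l p) \<and>
    (\<forall>p. pascal_line l p \<longrightarrow>
      (\<exists>q. q \<in> forms 4 \<and> q \<noteq> 0 \<and>
        (\<forall>j. A j \<in> zero_locus q) \<and>
        (\<forall>j. zero_locus (l j) \<inter> zero_locus (l (j + 2)) \<subseteq> zero_locus q) \<and>
        p * d 1 * d 2 * d 3 * q \<in> graded_part (sat_jacobian_ideal (hex_poly l d)) 8 \<and>
        p * d 1 * d 2 * d 3 * q \<notin> graded_part (jacobian_ideal (hex_poly l d)) 8))"
proof -
  note h = hex[unfolded hexagon_def]
  have vertex: "A j \<noteq> 0" for j using conjunct1[OF h] by blast
  have distinct_points: "\<not> same_point (A i) (A j)" if "i \<noteq> j" for i j
    using conjunct1[OF conjunct2[OF h]] that by blast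
  have side: "line_through (l j) (A j) (A (j + 1))" for j
    using conjunct1[OF conjunct2[OF conjunct2[OF h]]] by blast
  have diagonal: "line_through (d k) (A k) (A (k + 3))" if "k \<in> {1, 2, 3}" for k
    using conjunct2[OF conjunct2[OF conjunct2[OF h]]] that by blast
  have "\<forall>j. \<exists>a. l j = lin_form a"
    using side forms_1_eq_lin_form unfolding line_through_def linear_form_def by meson
  then obtain L where "\<forall>j. l j = lin_form (L j)" by (rule choice[THEN exE])
  then have l: "l j = lin_form (L j)" for j by simp
  have "\<forall>k. \<exists>a. k \<in> {1, 2, 3} \<longrightarrow> d k = lin_form a"
    using diagonal forms_1_eq_lin_form unfolding line_through_def linear_form_def by meson
  then obtain D where "\<forall>k. k \<in> {1, 2, 3} \<longrightarrow> d k = lin_form (D k)" by (rule choice[THEN exE])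
  then have d: "d k = lin_form (D k)" if "k \<in> {1, 2, 3}" for k using that by blast
  let ?G = "case_sum L D"
  let ?Z = "\<lambda>a. zero_locus (lin_form (?G a))"
  have "hex_lines l d = ?Z ` line_index"
    unfolding hex_lines_def line_index_def image_Un image_image using l d by simp
  note lines = this
  have inj: "inj_on ?Z line_index"
    using nine_lines card_line_index unfolding lines
    by (intro eq_card_imp_inj_on) (auto simp: line_index_def)
  have mult: "multiplicity_at (hex_lines l d) P = card {a \<in> line_index. dot (?G a) P = 0}"
    if "P \<noteq> 0" for P
  proof -
    have "P \<in> ?Z a \<longleftrightarrow> dot (?G a) P = 0" for a
      using that by (simp add: zero_locus_lin_form)
    then have "{M \<in> hex_lines l d. P \<in> M} = ?Z ` {a \<in> line_index. dot (?G a) P = 0}"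
      unfolding lines by blast
    moreover have "inj_on ?Z {a \<in> line_index. dot (?G a) P = 0}"
      by (rule inj_on_subset[OF inj]) auto
    ultimately show ?thesis unfolding multiplicity_at_def by (simp add: card_image)
  qed
  have G0: "?G a \<noteq> 0" if "a \<in> line_index" for a
  proof
    assume "?G a = 0"
    then have G: "lin_form (?G a) = 0" by simp
    have nonzero: "l j \<noteq> 0" "k \<in> {1, 2, 3} \<Longrightarrow> d k \<noteq> 0" for j k
      using side diagonal unfolding line_through_def linear_form_def by blast+
    show False
    proof (cases a)
      case (Inl j)
      then show ?thesis using G nonzero(1)[of j] l by simp
    next
      case (Inr k)
      then have k: "k \<in> {1, 2, 3}" using that unfolding line_index_def by blast
      then show ?thesis using Inr G nonzero(2)[OF k] d[OF k] by simp
    qed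
  qed
  interpret H: hexagon_lines A L D
  proof
    show "cross_prod (A i) (A j) \<noteq> 0" if "i \<noteq> j" for i j
    proof
      assume "cross_prod (A i) (A j) = 0"
      then obtain c where c: "A j = c *s A i" using cross_prod_eq_0 vertex by metis
      then have "c \<noteq> 0" using vertex[of j] by auto
      then have "same_point (A j) (A i)" using c unfolding same_point_def by blast
      then show False using distinct_points that by metis
    qed
    show "dot (L j) (A j) = 0" "dot (L j) (A (j + 1)) = 0" for j
      using side[of j] unfolding line_through_def l zero_locus_lin_form by blast+
    show "dot (D k) (A k) = 0" "dot (D k) (A (k + 3)) = 0" if "k \<in> {1, 2, 3}" for k
      using diagonal[OF that] unfolding line_through_def d[OF that] zero_locus_lin_form by blast+
    show "cross_prod (?G a) (?G b) \<noteq> 0" if ab: "a \<in> line_index" "b \<in> line_index" "a \<noteq> b" for a b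
    proof
      assume "cross_prod (?G a) (?G b) = 0"
      then obtain c where c: "?G b = c *s ?G a" using cross_prod_eq_0 G0[OF ab(1)] by metis
      then have "c \<noteq> 0" using G0[OF ab(2)] by auto
      then have "?Z b = ?Z a" unfolding zero_locus_lin_form c by simp
      then show False using inj ab by (auto dest: inj_onD)
    qed
    show "card {a \<in> line_index. dot (?G a) P = 0} \<le> 3" if P: "P \<noteq> 0" for P
    proof (cases "card {a \<in> line_index. dot (?G a) P = 0} \<ge> 2")
      case True
      then show ?thesis
        using only_double_or_triple P mult[OF P] unfolding double_point_def triple_point_def by fastforce
    qed simp
    show "card {a \<in> line_index. dot (?G a) P = 0} = 3 \<longleftrightarrow> (\<exists>j c. c \<noteq> 0 \<and> P = c *s A j)"
      if P: "P \<noteq> 0" for P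
      using triple_points P mult[OF P] unfolding triple_point_def same_point_def by metis
  qed
  obtain Q where Q: "Q \<in> forms 2" "Q \<noteq> 0" "\<forall>j. A j \<in> zero_locus Q"
  proof -
    obtain Q where Q: "smooth_conic Q \<or> two_lines_conic Q" "\<forall>j. A j \<in> zero_locus Q"
      using conic by blast
    from Q(1) have "Q \<in> forms 2 \<and> Q \<noteq> 0"
    proof
      assume "two_lines_conic Q"
      then obtain m m' where "m \<in> forms 1" "m' \<in> forms 1" "m \<noteq> 0" "m' \<noteq> 0" "Q = m * m'"
        unfolding two_lines_conic_def linear_form_def by blast
      then show ?thesis using forms_mult[of m 1 m' 1] by (simp add: numeral_2_eq_2)
    qed (simp add: smooth_conic_def)
    then show thesis using that Q(2) by blast
  qed
  obtain M where M: "\<And>v. eval Q v = (\<Sum>i\<in>UNIV. \<Sum>j\<in>UNIV. M i j * v $ i * v $ j)"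
    and "\<exists>v. eval Q v \<noteq> 0"
    using quadric_values_nonzero[OF Q(1,2)] by blast
  then obtain v where v: "eval Q v \<noteq> 0" by blast
  have QA: "eval Q (A j) = 0" for j using Q(3) by (simp add: zero_locus_def)
  obtain s E where s: "\<And>j. s j \<noteq> 0" and E: "\<And>j. s j *s L j + s (j + 3) *s L (j + 3) = E"
    using H.pascal[OF M v QA] by blast
  define n where "n j = s j *s L j" for j
  have nE: "n j + n (j + 3) = E" for j unfolding n_def by (rule E)
  have poly: "hex_poly l d = H.hex_product"
    unfolding hex_poly_def H.hex_product_def prod_line_index by (simp add: l d)
  define q where "q = hex_quartic n"
  have "pascal_line l (lin_form E)"
  proof -
    have "E \<noteq> 0"
    proof
      assume "E = 0"
      then have "s 1 *s L 1 = (- s 4) *s L 4" using E[of 1] by (simp add: eq_neg_iff_add_eq_0)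
      then have "s 1 *s cross_prod (L 1) (L 4) = cross_prod ((- s 4) *s L 4) (L 4)"
        by (simp only: flip: cross_prod_scale)
      also have "\<dots> = 0" by (simp only: cross_prod_scale cross_prod_self) simp
      finally show False using s H.sides_independent[of 1 4] by simp
    qed
    then obtain w where "dot E w = 1" using ex_dot_1 by blast
    then have "eval (lin_form E) w \<noteq> 0" by simp
    then have "lin_form E \<noteq> 0" by (metis eval_0)
    moreover have "dot E v = 0" if "dot (L k) v = 0" "dot (L (k + 3)) v = 0" for k v
      unfolding E[of k, symmetric] using that by simp
    ultimately show ?thesis
      unfolding pascal_line_def linear_form_def l zero_locus_lin_form using lin_form_forms by blast
  qed
  moreover have "\<exists>q. q \<in> forms 4 \<and> q \<noteq> 0 \<and>
        (\<forall>j. A j \<in> zero_locus q) \<and>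
        (\<forall>j. zero_locus (l j) \<inter> zero_locus (l (j + 2)) \<subseteq> zero_locus q) \<and>
        p * d 1 * d 2 * d 3 * q \<in> graded_part (sat_jacobian_ideal (hex_poly l d)) 8 \<and>
        p * d 1 * d 2 * d 3 * q \<notin> graded_part (jacobian_ideal (hex_poly l d)) 8"
    if p: "pascal_line l p" for p
  proof -
    obtain a where a: "p = lin_form a"
      using p forms_1_eq_lin_form unfolding pascal_line_def linear_form_def by blast
    have a0: "a \<noteq> 0" using p a unfolding pascal_line_def linear_form_def by auto
    have aB: "dot a v = 0" if "v \<noteq> 0" "dot (L j) v = 0" "dot (L (j + 3)) v = 0" for j v
    proof -
      have "dot a v = 0" if "k \<in> {1, 2, 3}" "v \<noteq> 0" "dot (L k) v = 0" "dot (L (k + 3)) v = 0" for k v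
        using p that unfolding pascal_line_def a l zero_locus_lin_form by auto
      from this[of 1] this[of 2] this[of 3]
      have "\<forall>j. v \<noteq> 0 \<longrightarrow> dot (L j) v = 0 \<longrightarrow> dot (L (j + 3)) v = 0 \<longrightarrow> dot a v = 0"
        unfolding forall_6 by (simp add: num_6)
      then show ?thesis using that by blast
    qed
    have h: "p * d 1 * d 2 * d 3 * q = H.hex_octic a n"
      unfolding H.hex_octic_def q_def a by (simp add: d)
    have "q \<noteq> 0"
    proof
      assume "q = 0"
      then show False
        using H.quartic_opposite[OF s n_def nE, of "cross_prod (L 1) (L 4)"] H.sides_independent[of 1 4]
        by (simp add: q_def)
    qed
    moreover have "A j \<in> zero_locus q" for j
      using H.quartic_vertex[OF s n_def nE] vertex by (simp add: zero_locus_def q_def)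
    moreover have "zero_locus (l j) \<inter> zero_locus (l (j + 2)) \<subseteq> zero_locus q" for j
      using H.quartic_alternate[OF s n_def nE, of j] by (auto simp: zero_locus_def q_def l)
    moreover have "p * d 1 * d 2 * d 3 * q \<in> graded_part (sat_jacobian_ideal (hex_poly l d)) 8"
      unfolding h poly graded_part_def
    proof (intro IntI H.octic_forms)
      show "H.hex_octic a n \<in> sat_jacobian_ideal H.hex_product"
        by (rule H.octic_in_saturation[OF s n_def nE]) (rule aB)
    qed
    moreover have "p * d 1 * d 2 * d 3 * q \<notin> graded_part (jacobian_ideal (hex_poly l d)) 8"
    proof -
      have "H.hex_octic a n \<notin> jacobian_ideal H.hex_product"
        by (rule H.octic_not_in_jacobian[OF s n_def nE]) (rule aB, assumption+, rule a0)
      then show ?thesis unfolding h poly graded_part_def by blast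
    qed
    moreover have "q \<in> forms 4" unfolding q_def by (rule hex_quartic_forms)
    ultimately show ?thesis by blast
  qed
  ultimately show ?thesis by blast
qed

end
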